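(* Let $\mathcal{A}$ be an abelian category, $n\geq 1$, $I=\{1,\dots,n\}$, let $G=(G_i)_{i\in I}$ be a family of additive left exact endofunctors of $\mathcal{A}$, each $G_i$ being the right adjoint of an endofunctor $F_i$ of $\mathcal{A}$, with a coassociative family $\Psi=(\Psi_{i,j}:G_{i+j}\to G_iG_j)$ of natural transformations. If $\mathcal{A}$ has enough injective objects, then the following assertions are equivalent for an object $(X,f)$ of the left $n$-trivial extension $G\rtimes_n\mathcal{A}$: (i) $(X,f)$ is injective. (ii) There exists an injective object $E$ in $\mathcal{A}$ such that $(X,f)$ is a direct summand of $H(E)$. (iii) $K(X,f)$ is injective and $H(K(X,f))\cong(X,f)$.
   Context: $\Psi$ consists of natural transformations $\Psi_{i,j}:G_{i+j}\to G_iG_j$ for $i,j\in I$ with $i+j\in I$; it is coassociative if $G_i((\Psi_{j,k})_X)\circ(\Psi_{i,j+k})_X=(\Psi_{i,j})_{G_kX}\circ(\Psi_{i+j,k})_X$ for all objects $X$ and all $i,j,k\in I$ with $i+j+k\in I$. Objects of $G\rtimes_n\mathcal{A}$ are pairs $(X,g)$ with $X$ in $\mathcal{A}$ and $g=(g_i:X\to G_iX)_{i\in I}$ such that for all $i,j\in I$: $G_i(g_j)\circ g_i=(\Psi_{i,j})_X\circ g_{i+j}$ if $i+j\leq n$, and $G_i(g_j)\circ g_i=0$ if $i+j>n$. A morphism $(X,\alpha)\to(Y,\beta)$ is a morphism $\gamma:X\to Y$ in $\mathcal{A}$ with $\beta_i\circ\gamma=G_i(\gamma)\circ\alpha_i$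 for all $i$. Functor $H:\mathcal{A}\to G\rtimes_n\mathcal{A}$: $H(X)=(G_nX\oplus\cdots\oplus G_1X\oplus X,\lambda)$, where $\lambda_i:G_nX\oplus\cdots\oplus G_1X\oplus X\to G_iG_nX\oplus\cdots\oplus G_iG_1X\oplus G_iX$ has component $\mathrm{id}:G_iX\to G_iX$, components $(\Psi_{i,j})_X:G_{i+j}X\to G_iG_jX$ for each $j$ with $i+j\leq n$, and all other components zero; $H(\alpha)=\mathrm{diag}(G_n\alpha,\dots,G_1\alpha,\alpha)$. Functor $K:G\rtimes_n\mathcal{A}\to\mathcal{A}$: $K(X,g)=\operatorname{Ker}\big((g_i)_i:X\to\bigoplus_{i\in I}G_iX\big)$, with the induced maps on morphisms. *)

theory Defs
  imports "HOL-Algebra.Group" "HOL-Algebra.FiniteProduct" "HOL-Library.FuncSet"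
begin

section \<open>Preadditive categories\<close>

text \<open>
  Categories are given by a set of objects, hom-sets, identities and a composition,
  written in the usual order of functions.  Hom-sets are not required to be disjoint.
  Composition and addition do not take the objects as arguments: this is no restriction,
  since any category can be presented with pairwise disjoint hom-sets, and it allows a morphism
  of the trivial extension below to be literally a morphism of the base category.
\<close>

record ('o, 'm) category =
  Obj :: "'o set"
  Hom :: "'o \<Rightarrow> 'o \<Rightarrow> 'm set"
  Ident :: "'o \<Rightarrow> 'm"
  Comp :: "'m \<Rightarrow> 'm \<Rightarrow> 'm" (infixr "\<cdot>\<index>" 70)

record ('o, 'm) preadd_category = "('o, 'm) category" +
  Add :: "'m \<Rightarrow> 'm \<Rightarrow> 'm"
  Zero :: "'o \<Rightarrow> 'o \<Rightarrow> 'm"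

locale is_category =
  fixes C :: "('o, 'm, 'z) category_scheme" (structure)
  assumes Ident_in_Hom: "X \<in> Obj C \<Longrightarrow> Ident C X \<in> Hom C X X"
    and Comp_in_Hom: "\<lbrakk>X \<in> Obj C; Y \<in> Obj C; Z \<in> Obj C; f \<in> Hom C X Y; g \<in> Hom C Y Z\<rbrakk>
      \<Longrightarrow> g \<cdot> f \<in> Hom C X Z"
    and Comp_Ident: "\<lbrakk>X \<in> Obj C; Y \<in> Obj C; f \<in> Hom C X Y\<rbrakk> \<Longrightarrow> f \<cdot> Ident C X = f"
    and Ident_Comp: "\<lbrakk>X \<in> Obj C; Y \<in> Obj C; f \<in> Hom C X Y\<rbrakk> \<Longrightarrow> Ident C Y \<cdot> f = f"
    and Comp_assoc: "\<lbrakk>W \<in> Obj C; X \<in> Obj C; Y \<in> Obj C; Z \<in> Obj C;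
        f \<in> Hom C W X; g \<in> Hom C X Y; h \<in> Hom C Y Z\<rbrakk>
      \<Longrightarrow> (h \<cdot> g) \<cdot> f = h \<cdot> (g \<cdot> f)"

text \<open>The abelian group of morphisms, written multiplicatively as in the library.\<close>

definition hom_group :: "('o, 'm, 'z) preadd_category_scheme \<Rightarrow> 'o \<Rightarrow> 'o \<Rightarrow> 'm monoid" where
  "hom_group C X Y = \<lparr>carrier = Hom C X Y, monoid.mult = Add C, one = Zero C X Y\<rparr>"

definition hom_sum ::
  "('o, 'm, 'z) preadd_category_scheme \<Rightarrow> 'o \<Rightarrow> 'o \<Rightarrow> ('i \<Rightarrow> 'm) \<Rightarrow> 'i set \<Rightarrow> 'm" where
  "hom_sum C X Y u J = finprod (hom_group C X Y) u J"

locale preadditive_category = is_category C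
  for C :: "('o, 'm, 'z) preadd_category_scheme" (structure) +
  assumes hom_comm_group: "\<lbrakk>X \<in> Obj C; Y \<in> Obj C\<rbrakk> \<Longrightarrow> comm_group (hom_group C X Y)"
    and Comp_Add_left: "\<lbrakk>X \<in> Obj C; Y \<in> Obj C; Z \<in> Obj C;
        f \<in> Hom C X Y; g \<in> Hom C Y Z; g' \<in> Hom C Y Z\<rbrakk>
      \<Longrightarrow> Add C g g' \<cdot> f = Add C (g \<cdot> f) (g' \<cdot> f)"
    and Comp_Add_right: "\<lbrakk>X \<in> Obj C; Y \<in> Obj C; Z \<in> Obj C;
        f \<in> Hom C X Y; f' \<in> Hom C X Y; g \<in> Hom C Y Z\<rbrakk>
      \<Longrightarrow> g \<cdot> Add C f f' = Add C (g \<cdot> f) (g \<cdot> f')"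

section \<open>Objects and morphisms\<close>

definition isomorphic_objects :: "('o, 'm, 'z) category_scheme \<Rightarrow> 'o \<Rightarrow> 'o \<Rightarrow> bool" where
  "isomorphic_objects C X Y \<longleftrightarrow> X \<in> Obj C \<and> Y \<in> Obj C \<and>
     (\<exists>u \<in> Hom C X Y. \<exists>v \<in> Hom C Y X. v \<cdot>\<^bsub>C\<^esub> u = Ident C X \<and> u \<cdot>\<^bsub>C\<^esub> v = Ident C Y)"

definition monic :: "('o, 'm, 'z) category_scheme \<Rightarrow> 'o \<Rightarrow> 'o \<Rightarrow> 'm \<Rightarrow> bool" where
  "monic C X Y f \<longleftrightarrow> X \<in> Obj C \<and> Y \<in> Obj C \<and> f \<in> Hom C X Y \<and>
     (\<forall>Z \<in> Obj C. \<forall>u \<in> Hom C Z X. \<forall>v \<in> Hom C Z X. f \<cdot>\<^bsub>C\<^esub> u = f \<cdot>\<^bsub>C\<^esub> v \<longrightarrow> u = v)"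

definition epic :: "('o, 'm, 'z) category_scheme \<Rightarrow> 'o \<Rightarrow> 'o \<Rightarrow> 'm \<Rightarrow> bool" where
  "epic C X Y f \<longleftrightarrow> X \<in> Obj C \<and> Y \<in> Obj C \<and> f \<in> Hom C X Y \<and>
     (\<forall>Z \<in> Obj C. \<forall>u \<in> Hom C Y Z. \<forall>v \<in> Hom C Y Z. u \<cdot>\<^bsub>C\<^esub> f = v \<cdot>\<^bsub>C\<^esub> f \<longrightarrow> u = v)"

definition injective_object :: "('o, 'm, 'z) category_scheme \<Rightarrow> 'o \<Rightarrow> bool" where
  "injective_object C E \<longleftrightarrow> E \<in> Obj C \<and>
     (\<forall>X Y m u. monic C X Y m \<and> u \<in> Hom C X E \<longrightarrow> (\<exists>v \<in> Hom C Y E. v \<cdot>\<^bsub>C\<^esub> m = u))"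

definition enough_injectives :: "('o, 'm, 'z) category_scheme \<Rightarrow> bool" where
  "enough_injectives C \<longleftrightarrow> (\<forall>X \<in> Obj C. \<exists>E m. injective_object C E \<and> monic C X E m)"

definition zero_object :: "('o, 'm, 'z) category_scheme \<Rightarrow> 'o \<Rightarrow> bool" where
  "zero_object C Z \<longleftrightarrow> Z \<in> Obj C \<and>
     (\<forall>X \<in> Obj C. (\<exists>!u. u \<in> Hom C X Z) \<and> (\<exists>!u. u \<in> Hom C Z X))"

text \<open>\<open>k : K \<rightarrow> X\<close> is a kernel of \<open>f : X \<rightarrow> Y\<close>; \<open>q : Y \<rightarrow> Q\<close> is a cokernel of \<open>f : X \<rightarrow> Y\<close>.\<close>

definition is_kernel ::
  "('o, 'm, 'z) preadd_category_scheme \<Rightarrow> 'o \<Rightarrow> 'o \<Rightarrow> 'm \<Rightarrow> 'o \<Rightarrow> 'm \<Rightarrow> bool" where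
  "is_kernel C X Y f K k \<longleftrightarrow> X \<in> Obj C \<and> Y \<in> Obj C \<and> K \<in> Obj C \<and>
     f \<in> Hom C X Y \<and> k \<in> Hom C K X \<and> f \<cdot>\<^bsub>C\<^esub> k = Zero C K Y \<and>
     (\<forall>Z \<in> Obj C. \<forall>t \<in> Hom C Z X. f \<cdot>\<^bsub>C\<^esub> t = Zero C Z Y \<longrightarrow>
        (\<exists>!u. u \<in> Hom C Z K \<and> k \<cdot>\<^bsub>C\<^esub> u = t))"

definition is_cokernel ::
  "('o, 'm, 'z) preadd_category_scheme \<Rightarrow> 'o \<Rightarrow> 'o \<Rightarrow> 'm \<Rightarrow> 'o \<Rightarrow> 'm \<Rightarrow> bool" where
  "is_cokernel C X Y f Q q \<longleftrightarrow> X \<in> Obj C \<and> Y \<in> Obj C \<and> Q \<in> Obj C \<and>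
     f \<in> Hom C X Y \<and> q \<in> Hom C Y Q \<and> q \<cdot>\<^bsub>C\<^esub> f = Zero C X Q \<and>
     (\<forall>Z \<in> Obj C. \<forall>t \<in> Hom C Y Z. t \<cdot>\<^bsub>C\<^esub> f = Zero C X Z \<longrightarrow>
        (\<exists>!u. u \<in> Hom C Q Z \<and> u \<cdot>\<^bsub>C\<^esub> q = t))"

definition is_biproduct2 ::
  "('o, 'm, 'z) preadd_category_scheme \<Rightarrow> 'o \<Rightarrow> 'o \<Rightarrow> 'o \<Rightarrow> 'm \<Rightarrow> 'm \<Rightarrow> 'm \<Rightarrow> 'm \<Rightarrow> bool" where
  "is_biproduct2 C X Y S i1 i2 p1 p2 \<longleftrightarrow> X \<in> Obj C \<and> Y \<in> Obj C \<and> S \<in> Obj C \<and>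
     i1 \<in> Hom C X S \<and> i2 \<in> Hom C Y S \<and> p1 \<in> Hom C S X \<and> p2 \<in> Hom C S Y \<and>
     p1 \<cdot>\<^bsub>C\<^esub> i1 = Ident C X \<and> p2 \<cdot>\<^bsub>C\<^esub> i2 = Ident C Y \<and>
     p1 \<cdot>\<^bsub>C\<^esub> i2 = Zero C Y X \<and> p2 \<cdot>\<^bsub>C\<^esub> i1 = Zero C X Y \<and>
     Add C (i1 \<cdot>\<^bsub>C\<^esub> p1) (i2 \<cdot>\<^bsub>C\<^esub> p2) = Ident C S"

definition is_biproduct ::
  "('o, 'm, 'z) preadd_category_scheme \<Rightarrow> 'i set \<Rightarrow> ('i \<Rightarrow> 'o) \<Rightarrow> 'o \<Rightarrow> ('i \<Rightarrow> 'm) \<Rightarrow> ('i \<Rightarrow> 'm) \<Rightarrow> bool"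
  where
  "is_biproduct C J A S \<iota> \<pi> \<longleftrightarrow> finite J \<and> S \<in> Obj C \<and>
     (\<forall>j \<in> J. A j \<in> Obj C \<and> \<iota> j \<in> Hom C (A j) S \<and> \<pi> j \<in> Hom C S (A j)) \<and>
     (\<forall>j \<in> J. \<forall>k \<in> J. \<pi> j \<cdot>\<^bsub>C\<^esub> \<iota> k = (if j = k then Ident C (A j) else Zero C (A k) (A j))) \<and>
     hom_sum C S S (\<lambda>j. \<iota> j \<cdot>\<^bsub>C\<^esub> \<pi> j) J = Ident C S"

definition direct_summand :: "('o, 'm, 'z) preadd_category_scheme \<Rightarrow> 'o \<Rightarrow> 'o \<Rightarrow> bool" where
  "direct_summand C X S \<longleftrightarrow> (\<exists>Y i1 i2 p1 p2. is_biproduct2 C X Y S i1 i2 p1 p2)"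

locale abelian_category = preadditive_category C
  for C :: "('o, 'm, 'z) preadd_category_scheme" (structure) +
  assumes ex_zero_object: "\<exists>Z. zero_object C Z"
    and ex_biproduct2: "\<lbrakk>X \<in> Obj C; Y \<in> Obj C\<rbrakk> \<Longrightarrow> \<exists>S i1 i2 p1 p2. is_biproduct2 C X Y S i1 i2 p1 p2"
    and ex_kernel: "\<lbrakk>X \<in> Obj C; Y \<in> Obj C; f \<in> Hom C X Y\<rbrakk> \<Longrightarrow> \<exists>K k. is_kernel C X Y f K k"
    and ex_cokernel: "\<lbrakk>X \<in> Obj C; Y \<in> Obj C; f \<in> Hom C X Y\<rbrakk> \<Longrightarrow> \<exists>Q q. is_cokernel C X Y f Q q"
    and monic_is_kernel: "monic C X Y m \<Longrightarrow> \<exists>Z f. is_kernel C Y Z f X m"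
    and epic_is_cokernel: "epic C X Y e \<Longrightarrow> \<exists>Z f. is_cokernel C Z X f Y e"

text \<open>
  Direct sums and kernels exist in an abelian category but are determined only up to isomorphism;
  an arbitrary choice is fixed.
\<close>

definition dsum ::
  "('o, 'm, 'z) preadd_category_scheme \<Rightarrow> 'i set \<Rightarrow> ('i \<Rightarrow> 'o) \<Rightarrow> 'o \<times> ('i \<Rightarrow> 'm) \<times> ('i \<Rightarrow> 'm)" where
  "dsum C J A = (SOME (S, \<iota>, \<pi>). is_biproduct C J A S \<iota> \<pi>)"

definition dsum_obj :: "('o, 'm, 'z) preadd_category_scheme \<Rightarrow> 'i set \<Rightarrow> ('i \<Rightarrow> 'o) \<Rightarrow> 'o" where
  "dsum_obj C J A = fst (dsum C J A)"

definition dsum_inj :: "('o, 'm, 'z) preadd_category_scheme \<Rightarrow> 'i set \<Rightarrow> ('i \<Rightarrow> 'o) \<Rightarrow> 'i \<Rightarrow> 'm" where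
  "dsum_inj C J A = fst (snd (dsum C J A))"

definition dsum_proj :: "('o, 'm, 'z) preadd_category_scheme \<Rightarrow> 'i set \<Rightarrow> ('i \<Rightarrow> 'o) \<Rightarrow> 'i \<Rightarrow> 'm" where
  "dsum_proj C J A = snd (snd (dsum C J A))"

definition kernel_obj :: "('o, 'm, 'z) preadd_category_scheme \<Rightarrow> 'o \<Rightarrow> 'o \<Rightarrow> 'm \<Rightarrow> 'o" where
  "kernel_obj C X Y f = fst (SOME (K, k). is_kernel C X Y f K k)"

section \<open>Functors\<close>

record ('o, 'm, 'p, 'q) functor_data =
  omap :: "'o \<Rightarrow> 'p"
  amap :: "'m \<Rightarrow> 'q"

type_synonym ('o, 'm) endofunctor_data = "('o, 'm, 'o, 'm) functor_data"

definition is_functor ::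
  "('o, 'm, 'z) category_scheme \<Rightarrow> ('p, 'q, 'w) category_scheme \<Rightarrow> ('o, 'm, 'p, 'q) functor_data \<Rightarrow> bool"
  where
  "is_functor C D F \<longleftrightarrow>
     (\<forall>X \<in> Obj C. omap F X \<in> Obj D \<and> amap F (Ident C X) = Ident D (omap F X)) \<and>
     (\<forall>X \<in> Obj C. \<forall>Y \<in> Obj C. \<forall>f \<in> Hom C X Y. amap F f \<in> Hom D (omap F X) (omap F Y)) \<and>
     (\<forall>X \<in> Obj C. \<forall>Y \<in> Obj C. \<forall>Z \<in> Obj C. \<forall>f \<in> Hom C X Y. \<forall>g \<in> Hom C Y Z.
        amap F (g \<cdot>\<^bsub>C\<^esub> f) = amap F g \<cdot>\<^bsub>D\<^esub> amap F f)"

definition additive_functor ::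
  "('o, 'm, 'z) preadd_category_scheme \<Rightarrow> ('p, 'q, 'w) preadd_category_scheme \<Rightarrow>
     ('o, 'm, 'p, 'q) functor_data \<Rightarrow> bool" where
  "additive_functor C D F \<longleftrightarrow> is_functor C D F \<and>
     (\<forall>X \<in> Obj C. \<forall>Y \<in> Obj C. \<forall>f \<in> Hom C X Y. \<forall>g \<in> Hom C X Y.
        amap F (Add C f g) = Add D (amap F f) (amap F g))"

text \<open>
  A sequence \<open>0 \<rightarrow> K \<rightarrow> X \<rightarrow> Y\<close> in an abelian category is exact iff \<open>K \<rightarrow> X\<close> is a kernel of \<open>X \<rightarrow> Y\<close>.
\<close>

definition left_exact_functor ::
  "('o, 'm, 'z) preadd_category_scheme \<Rightarrow> ('p, 'q, 'w) preadd_category_scheme \<Rightarrow>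
     ('o, 'm, 'p, 'q) functor_data \<Rightarrow> bool" where
  "left_exact_functor C D F \<longleftrightarrow> is_functor C D F \<and>
     (\<forall>X Y f K k. is_kernel C X Y f K k \<longrightarrow>
        is_kernel D (omap F X) (omap F Y) (amap F f) (omap F K) (amap F k))"

definition functor_comp ::
  "('p, 'q, 'r, 's) functor_data \<Rightarrow> ('o, 'm, 'p, 'q) functor_data \<Rightarrow> ('o, 'm, 'r, 's) functor_data"
  where
  "functor_comp G F = \<lparr>omap = omap G \<circ> omap F, amap = amap G \<circ> amap F\<rparr>"

definition natural_transformation ::
  "('o, 'm, 'z) category_scheme \<Rightarrow> ('p, 'q, 'w) category_scheme \<Rightarrow>
     ('o, 'm, 'p, 'q) functor_data \<Rightarrow> ('o, 'm, 'p, 'q) functor_data \<Rightarrow> ('o \<Rightarrow> 'q) \<Rightarrow> bool" where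
  "natural_transformation C D F G \<eta> \<longleftrightarrow>
     (\<forall>X \<in> Obj C. \<eta> X \<in> Hom D (omap F X) (omap G X)) \<and>
     (\<forall>X \<in> Obj C. \<forall>Y \<in> Obj C. \<forall>f \<in> Hom C X Y. \<eta> Y \<cdot>\<^bsub>D\<^esub> amap F f = amap G f \<cdot>\<^bsub>D\<^esub> \<eta> X)"

text \<open>\<open>G : D \<rightarrow> C\<close> is right adjoint to \<open>F : C \<rightarrow> D\<close>.\<close>

definition right_adjoint_of ::
  "('o, 'm, 'z) category_scheme \<Rightarrow> ('p, 'q, 'w) category_scheme \<Rightarrow>
     ('p, 'q, 'o, 'm) functor_data \<Rightarrow> ('o, 'm, 'p, 'q) functor_data \<Rightarrow> bool" where
  "right_adjoint_of C D G F \<longleftrightarrow> is_functor C D F \<and> is_functor D C G \<and>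
     (\<exists>\<phi>. (\<forall>X \<in> Obj C. \<forall>Y \<in> Obj D. bij_betw (\<phi> X Y) (Hom D (omap F X) Y) (Hom C X (omap G Y))) \<and>
       (\<forall>X \<in> Obj C. \<forall>X' \<in> Obj C. \<forall>Y \<in> Obj D. \<forall>Y' \<in> Obj D.
          \<forall>a \<in> Hom C X' X. \<forall>b \<in> Hom D Y Y'. \<forall>h \<in> Hom D (omap F X) Y.
            \<phi> X' Y' (b \<cdot>\<^bsub>D\<^esub> h \<cdot>\<^bsub>D\<^esub> amap F a) = amap G b \<cdot>\<^bsub>C\<^esub> \<phi> X Y h \<cdot>\<^bsub>C\<^esub> a))"

section \<open>Left trivial extensions\<close>

definition natural_family ::
  "('o, 'm, 'z) category_scheme \<Rightarrow> nat \<Rightarrow> (nat \<Rightarrow> ('o, 'm) endofunctor_data) \<Rightarrow>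
     (nat \<Rightarrow> nat \<Rightarrow> 'o \<Rightarrow> 'm) \<Rightarrow> bool" where
  "natural_family C n G \<Psi> \<longleftrightarrow>
     (\<forall>i \<in> {1..n}. \<forall>j \<in> {1..n}. i + j \<in> {1..n} \<longrightarrow>
        natural_transformation C C (G (i + j)) (functor_comp (G i) (G j)) (\<Psi> i j))"

definition coassociative ::
  "('o, 'm, 'z) category_scheme \<Rightarrow> nat \<Rightarrow> (nat \<Rightarrow> ('o, 'm) endofunctor_data) \<Rightarrow>
     (nat \<Rightarrow> nat \<Rightarrow> 'o \<Rightarrow> 'm) \<Rightarrow> bool" where
  "coassociative C n G \<Psi> \<longleftrightarrow>
     (\<forall>X \<in> Obj C. \<forall>i \<in> {1..n}. \<forall>j \<in> {1..n}. \<forall>k \<in> {1..n}. i + j + k \<in> {1..n} \<longrightarrow>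
        amap (G i) (\<Psi> j k X) \<cdot>\<^bsub>C\<^esub> \<Psi> i (j + k) X = \<Psi> i j (omap (G k) X) \<cdot>\<^bsub>C\<^esub> \<Psi> (i + j) k X)"

definition trivial_extension ::
  "('o, 'm, 'z) preadd_category_scheme \<Rightarrow> nat \<Rightarrow> (nat \<Rightarrow> ('o, 'm) endofunctor_data) \<Rightarrow>
     (nat \<Rightarrow> nat \<Rightarrow> 'o \<Rightarrow> 'm) \<Rightarrow> ('o \<times> (nat \<Rightarrow> 'm), 'm) preadd_category" where
  "trivial_extension C n G \<Psi> =
    \<lparr>Obj = {(X, g). X \<in> Obj C \<and> g \<in> (\<Pi>\<^sub>E i\<in>{1..n}. Hom C X (omap (G i) X)) \<and>
             (\<forall>i \<in> {1..n}. \<forall>j \<in> {1..n}.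
                amap (G i) (g j) \<cdot>\<^bsub>C\<^esub> g i =
                  (if i + j \<le> n then \<Psi> i j X \<cdot>\<^bsub>C\<^esub> g (i + j)
                   else Zero C X (omap (G i) (omap (G j) X))))},
     Hom = (\<lambda>(X, \<alpha>) (Y, \<beta>). {\<gamma> \<in> Hom C X Y. \<forall>i \<in> {1..n}. \<beta> i \<cdot>\<^bsub>C\<^esub> \<gamma> = amap (G i) \<gamma> \<cdot>\<^bsub>C\<^esub> \<alpha> i}),
     Ident = (\<lambda>(X, \<alpha>). Ident C X),
     Comp = Comp C,
     Add = Add C,
     Zero = (\<lambda>(X, \<alpha>) (Y, \<beta>). Zero C X Y)\<rparr>"

text \<open>
  The summands of the underlying object of \<open>H(X)\<close> are indexed by \<open>{0..n}\<close>, the index \<open>0\<close> standing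
  for the summand \<open>X\<close>.
\<close>

definition H_summand :: "(nat \<Rightarrow> ('o, 'm) endofunctor_data) \<Rightarrow> 'o \<Rightarrow> nat \<Rightarrow> 'o" where
  "H_summand G X j = (if j = 0 then X else omap (G j) X)"

definition H_component ::
  "('o, 'm, 'z) preadd_category_scheme \<Rightarrow> (nat \<Rightarrow> ('o, 'm) endofunctor_data) \<Rightarrow>
     (nat \<Rightarrow> nat \<Rightarrow> 'o \<Rightarrow> 'm) \<Rightarrow> 'o \<Rightarrow> nat \<Rightarrow> nat \<Rightarrow> nat \<Rightarrow> 'm" where
  "H_component C G \<Psi> X i j k =
     (if k = i + j then (if j = 0 then Ident C (omap (G i) X) else \<Psi> i j X)
      else Zero C (H_summand G X k) (omap (G i) (H_summand G X j)))"

text \<open>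
  Since \<open>G i\<close> is additive, \<open>G i\<close> applied to the direct sum is the direct sum of the objects
  \<open>G i (H_summand G X j)\<close>, with projections \<open>amap (G i) (\<pi> j)\<close>; thus \<open>\<lambda>\<^sub>i\<close> is the morphism
  whose component from the \<open>k\<close>-th to the \<open>j\<close>-th summand is \<open>H_component C G \<Psi> X i j k\<close>.
\<close>

definition H_obj ::
  "('o, 'm, 'z) preadd_category_scheme \<Rightarrow> nat \<Rightarrow> (nat \<Rightarrow> ('o, 'm) endofunctor_data) \<Rightarrow>
     (nat \<Rightarrow> nat \<Rightarrow> 'o \<Rightarrow> 'm) \<Rightarrow> 'o \<Rightarrow> 'o \<times> (nat \<Rightarrow> 'm)" where
  "H_obj C n G \<Psi> X =
    (let S = dsum_obj C {0..n} (H_summand G X);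
         \<iota> = dsum_inj C {0..n} (H_summand G X);
         \<pi> = dsum_proj C {0..n} (H_summand G X)
     in (S, \<lambda>i\<in>{1..n}. THE l. l \<in> Hom C S (omap (G i) S) \<and>
          (\<forall>j \<in> {0..n}. \<forall>k \<in> {0..n}.
             amap (G i) (\<pi> j) \<cdot>\<^bsub>C\<^esub> l \<cdot>\<^bsub>C\<^esub> \<iota> k = H_component C G \<Psi> X i j k)))"

definition K_obj ::
  "('o, 'm, 'z) preadd_category_scheme \<Rightarrow> nat \<Rightarrow> (nat \<Rightarrow> ('o, 'm) endofunctor_data) \<Rightarrow>
     'o \<times> (nat \<Rightarrow> 'm) \<Rightarrow> 'o" where
  "K_obj C n G = (\<lambda>(X, g).
    (let A = (\<lambda>i. omap (G i) X);
         T = dsum_obj C {1..n} A;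
         m = (THE m. m \<in> Hom C X T \<and> (\<forall>i \<in> {1..n}. dsum_proj C {1..n} A i \<cdot>\<^bsub>C\<^esub> m = g i))
     in kernel_obj C X T m))"

end

theory Submission
  imports Defs
begin

text \<open>
  \<open>H\<close> is right adjoint to the forgetful functor from the trivial extension to \<open>\<A>\<close>. Kernels in the
  extension are computed in \<open>\<A>\<close> by left exactness of the \<open>G\<^sub>i\<close>, so the forgetful functor preserves
  monomorphisms and \<open>H\<close> preserves injectives; embedding \<open>X\<close> into an injective \<open>E\<close> then embeds
  \<open>(X, f)\<close> into \<open>H(E)\<close>. Dually \<open>K\<close> is right adjoint to \<open>P \<mapsto> (P, 0)\<close> and preserves injectives.
  For injective \<open>(X, f)\<close> this gives a morphism \<open>(X, f) \<rightarrow> H(K(X, f))\<close> inducing an isomorphism on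
  \<open>K\<close>, and it is invertible because an object killed by \<open>K\<close> is zero.
\<close>

section \<open>Preadditive categories\<close>

text \<open>Why \<open>H\<close> is cofree: \<open>\<lambda>\<close> followed by the projection
  \<open>amap (G i) (\<pi> 0)\<close> is just \<open>\<pi> i\<close>. Hence a morphism
  \<open>h\<close> from \<open>(X, g)\<close> into \<open>H(Y)\<close> has \<open>i\<close>-th
  component \<open>amap (G i) \<phi> \<cdot> g i\<close>, where \<open>\<phi>\<close> is its
  component at index 0. Conversely, these components form a morphism for every
  \<open>\<phi>\<close>, by naturality of \<open>\<Psi>\<close> and the two equations required of
  \<open>g\<close>. The obstacle is that \<open>H_obj\<close> and \<open>K_obj\<close> come from
  \<open>SOME\<close> and \<open>THE\<close>, with biproducts known only up to a choice. Each is
  therefore replaced at once by a property (\<open>is_cofree\<close>,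
  \<open>K_obj_universal\<close>) that holds whichever biproduct is chosen, and maps are compared
  through their components. This works inside \<open>G i\<close> because an additive functor
  preserves biproducts and a left exact one preserves monomorphisms. Of the extension itself only
  the category laws are established. Direct summands are therefore built by hand: the complement is
  the base kernel of the retraction with an induced structure, and its projection comes from the
  identity minus the idempotent.\<close>

text \<open>Hom-sets are unconstrained outside \<open>Obj\<close>, so every category law carries
  membership side conditions. Bundling them into one judgement lets the laws be chained by
  \<open>OF\<close>.\<close>

definition arr :: "('o, 'm, 'z) category_scheme \<Rightarrow> 'm \<Rightarrow> 'o \<Rightarrow> 'o \<Rightarrow> bool"
    ("_ \<Zcolon>\<index> _ \<rightarrow> _" [61, 61, 61] 50) where
  "f \<Zcolon>\<^bsub>C\<^esub> X \<rightarrow> Y \<longleftrightarrow> X \<in> Obj C \<and> Y \<in> Obj C \<and> f \<in> Hom C X Y"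

lemma arr_obj: "f \<Zcolon>\<^bsub>C\<^esub> X \<rightarrow> Y \<Longrightarrow> X \<in> Obj C" "f \<Zcolon>\<^bsub>C\<^esub> X \<rightarrow> Y \<Longrightarrow> Y \<in> Obj C"
  by (auto simp: arr_def)

section \<open>Monomorphisms and injective objects in terms of typed arrows\<close>

lemma monic_arr: "monic C X Y m \<Longrightarrow> m \<Zcolon>\<^bsub>C\<^esub> X \<rightarrow> Y"
  by (auto simp: monic_def arr_def)

lemma monic_cancel:
  "\<lbrakk>monic C X Y m; u \<Zcolon>\<^bsub>C\<^esub> Z \<rightarrow> X; v \<Zcolon>\<^bsub>C\<^esub> Z \<rightarrow> X; m \<cdot>\<^bsub>C\<^esub> u = m \<cdot>\<^bsub>C\<^esub> v\<rbrakk> \<Longrightarrow> u = v"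
  by (auto simp: monic_def arr_def)

lemma injective_object_obj: "injective_object C E \<Longrightarrow> E \<in> Obj C"
  by (simp add: injective_object_def)

lemma injective_object_extend:
  assumes "injective_object C E" "monic C X Y m" "u \<Zcolon>\<^bsub>C\<^esub> X \<rightarrow> E"
  obtains v where "v \<Zcolon>\<^bsub>C\<^esub> Y \<rightarrow> E" "v \<cdot>\<^bsub>C\<^esub> m = u"
proof -
  have "Y \<in> Obj C" "E \<in> Obj C" using assms(1,2) by (auto simp: injective_object_def monic_def)
  moreover obtain v where "v \<in> Hom C Y E" "v \<cdot>\<^bsub>C\<^esub> m = u"
    using assms unfolding injective_object_def arr_def by blast
  ultimately show thesis using that by (auto simp: arr_def)
qed

context is_category
begin

lemma ident_arr: "X \<in> Obj C \<Longrightarrow> Ident C X \<Zcolon> X \<rightarrow> X"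
  by (simp add: arr_def Ident_in_Hom)

lemma comp_arr: "\<lbrakk>g \<Zcolon> Y \<rightarrow> Z; f \<Zcolon> X \<rightarrow> Y\<rbrakk> \<Longrightarrow> g \<cdot> f \<Zcolon> X \<rightarrow> Z"
  by (auto simp: arr_def intro: Comp_in_Hom)

lemma comp_ident: "f \<Zcolon> X \<rightarrow> Y \<Longrightarrow> f \<cdot> Ident C X = f"
  by (auto simp: arr_def intro: Comp_Ident)

lemma ident_comp: "f \<Zcolon> X \<rightarrow> Y \<Longrightarrow> Ident C Y \<cdot> f = f"
  by (auto simp: arr_def intro: Ident_Comp)

lemma comp_assoc:
  "\<lbrakk>h \<Zcolon> Y \<rightarrow> Z; g \<Zcolon> X \<rightarrow> Y; f \<Zcolon> W \<rightarrow> X\<rbrakk> \<Longrightarrow> (h \<cdot> g) \<cdot> f = h \<cdot> (g \<cdot> f)"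
  by (auto simp: arr_def intro: Comp_assoc)

text \<open>Extend \<open>s \<cdot> u\<close> into \<open>E\<close>, then return along
  \<open>r\<close>. Stated for a bare category so that it applies to the trivial extension; it
  serves both for direct summands and for isomorphic copies.\<close>

lemma injective_retract:
  assumes E: "injective_object C E" and s: "s \<Zcolon> X \<rightarrow> E" and r: "r \<Zcolon> E \<rightarrow> X"
    and rs: "r \<cdot> s = Ident C X"
  shows "injective_object C X"
  unfolding injective_object_def
proof (intro conjI allI impI)
  show "X \<in> Obj C" using s by (rule arr_obj)
  fix P Q m u
  assume mu: "monic C P Q m \<and> u \<in> Hom C P X"
  then have m: "monic C P Q m" and u: "u \<Zcolon> P \<rightarrow> X"
    using arr_obj(1)[OF s] by (auto simp: arr_def monic_def)
  obtain v where v: "v \<Zcolon> Q \<rightarrow> E" "v \<cdot> m = s \<cdot> u"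
    using injective_object_extend[OF E m comp_arr[OF s u]] .
  have "(r \<cdot> v) \<cdot> m = r \<cdot> (s \<cdot> u)"
    using comp_assoc[OF r v(1) monic_arr[OF m]] v(2) by simp
  also have "\<dots> = u"
    using comp_assoc[OF r s u] rs ident_comp[OF u] by simp
  finally show "\<exists>v \<in> Hom C Q X. v \<cdot> m = u"
    using comp_arr[OF r v(1)] by (auto simp: arr_def)
qed

end

context preadditive_category
begin

section \<open>Arithmetic of hom-groups\<close>

lemma hom_group_simps [simp]:
  "carrier (hom_group C X Y) = Hom C X Y" "monoid.mult (hom_group C X Y) = Add C"
  "one (hom_group C X Y) = Zero C X Y"
  by (simp_all add: hom_group_def)

lemma comm_group_arr: "f \<Zcolon> X \<rightarrow> Y \<Longrightarrow> comm_group (hom_group C X Y)"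
  by (simp add: arr_def hom_comm_group)

lemma zero_arr: "\<lbrakk>X \<in> Obj C; Y \<in> Obj C\<rbrakk> \<Longrightarrow> Zero C X Y \<Zcolon> X \<rightarrow> Y"
  using monoid.one_closed[OF group.is_monoid[OF comm_group.axioms(2)[OF hom_comm_group]], of X Y]
  by (simp add: arr_def)

lemma add_arr: "\<lbrakk>f \<Zcolon> X \<rightarrow> Y; g \<Zcolon> X \<rightarrow> Y\<rbrakk> \<Longrightarrow> Add C f g \<Zcolon> X \<rightarrow> Y"
  using monoid.m_closed[OF group.is_monoid[OF comm_group.axioms(2)[OF comm_group_arr]], of f X Y f g]
  by (simp add: arr_def)

lemma add_zero: "f \<Zcolon> X \<rightarrow> Y \<Longrightarrow> Add C f (Zero C X Y) = f"
  using monoid.r_one[OF group.is_monoid[OF comm_group.axioms(2)[OF comm_group_arr]], of f X Y f]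
  by (simp add: arr_def)

lemma zero_add: "f \<Zcolon> X \<rightarrow> Y \<Longrightarrow> Add C (Zero C X Y) f = f"
  using monoid.l_one[OF group.is_monoid[OF comm_group.axioms(2)[OF comm_group_arr]], of f X Y f]
  by (simp add: arr_def)

lemma add_assoc: "\<lbrakk>f \<Zcolon> X \<rightarrow> Y; g \<Zcolon> X \<rightarrow> Y; h \<Zcolon> X \<rightarrow> Y\<rbrakk>
    \<Longrightarrow> Add C (Add C f g) h = Add C f (Add C g h)"
  using monoid.m_assoc[OF group.is_monoid[OF comm_group.axioms(2)[OF comm_group_arr]], of f X Y f g h]
  by (simp add: arr_def)

lemma add_cancel:
  assumes "f \<Zcolon> X \<rightarrow> Y" "g \<Zcolon> X \<rightarrow> Y" "h \<Zcolon> X \<rightarrow> Y" "Add C f g = Add C f h"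
  shows "g = h"
proof -
  interpret comm_group "hom_group C X Y" using comm_group_arr[OF assms(1)] .
  show ?thesis using Units_l_cancel[of f g h] assms by (simp add: Units_eq arr_def)
qed

text \<open>The record has no subtraction, so negatives are obtained by existence from the group
  structure.\<close>

lemma ex_neg:
  assumes "f \<Zcolon> X \<rightarrow> Y"
  obtains g where "g \<Zcolon> X \<rightarrow> Y" "Add C f g = Zero C X Y"
proof -
  interpret comm_group "hom_group C X Y" using comm_group_arr[OF assms] .
  have f: "f \<in> carrier (hom_group C X Y)" using assms by (simp add: arr_def)
  show thesis
    using that[of "inv\<^bsub>hom_group C X Y\<^esub> f"] inv_closed[OF f] r_inv[OF f] assms
    by (simp add: arr_def)
qed

lemma comp_add_left: "\<lbrakk>g \<Zcolon> Y \<rightarrow> Z; g' \<Zcolon> Y \<rightarrow> Z; f \<Zcolon> X \<rightarrow> Y\<rbrakk>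
    \<Longrightarrow> Add C g g' \<cdot> f = Add C (g \<cdot> f) (g' \<cdot> f)"
  by (auto simp: arr_def intro: Comp_Add_left)

lemma comp_add_right: "\<lbrakk>g \<Zcolon> Y \<rightarrow> Z; f \<Zcolon> X \<rightarrow> Y; f' \<Zcolon> X \<rightarrow> Y\<rbrakk>
    \<Longrightarrow> g \<cdot> Add C f f' = Add C (g \<cdot> f) (g \<cdot> f')"
  by (auto simp: arr_def intro: Comp_Add_right)

text \<open>The device by which additivity yields preservation of zero, for composition on either
  side and for additive functors.\<close>

lemma add_idem_zero: "\<lbrakk>f \<Zcolon> X \<rightarrow> Y; Add C f f = f\<rbrakk> \<Longrightarrow> f = Zero C X Y"
  using add_cancel[of f X Y f "Zero C X Y"] add_zero[of f X Y] zero_arr[of X Y] arr_obj[of C f X Y]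
  by auto

lemma comp_zero:
  assumes g: "g \<Zcolon> Y \<rightarrow> Z" and X: "X \<in> Obj C"
  shows "g \<cdot> Zero C X Y = Zero C X Z"
proof -
  note z = zero_arr[OF X arr_obj(1)[OF g]]
  show ?thesis
    using add_idem_zero[OF comp_arr[OF g z]] comp_add_right[OF g z z] add_zero[OF z] by simp
qed

lemma zero_comp:
  assumes f: "f \<Zcolon> X \<rightarrow> Y" and Z: "Z \<in> Obj C"
  shows "Zero C Y Z \<cdot> f = Zero C X Z"
proof -
  note z = zero_arr[OF arr_obj(2)[OF f] Z]
  show ?thesis
    using add_idem_zero[OF comp_arr[OF z f]] comp_add_left[OF z z f] add_zero[OF z] by simp
qed

section \<open>Monomorphisms and kernels\<close>

lemma monicI:
  assumes m: "m \<Zcolon> X \<rightarrow> Y"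
    and z: "\<And>Z t. \<lbrakk>t \<Zcolon> Z \<rightarrow> X; m \<cdot> t = Zero C Z Y\<rbrakk> \<Longrightarrow> t = Zero C Z X"
  shows "monic C X Y m"
  unfolding monic_def
proof (intro conjI ballI impI)
  show "X \<in> Obj C" "Y \<in> Obj C" "m \<in> Hom C X Y" using m by (auto simp: arr_def)
  fix Z u v assume Z: "Z \<in> Obj C" and "u \<in> Hom C Z X" "v \<in> Hom C Z X" and eq: "m \<cdot> u = m \<cdot> v"
  then have u: "u \<Zcolon> Z \<rightarrow> X" and v: "v \<Zcolon> Z \<rightarrow> X" using m by (auto simp: arr_def)
  \<comment> \<open>\<open>w\<close> is minus \<open>v\<close>, so \<open>Add C u w\<close> is the
    difference to which \<open>z\<close> is applied.\<close>
  obtain w where w: "w \<Zcolon> Z \<rightarrow> X" "Add C v w = Zero C Z X" using ex_neg[OF v] .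
  have "m \<cdot> Add C u w = Add C (m \<cdot> v) (m \<cdot> w)" using comp_add_right[OF m u w(1)] eq by simp
  also have "\<dots> = Zero C Z Y"
    using comp_add_right[OF m v w(1)] w(2) comp_zero[OF m Z] by simp
  finally have uw: "Add C u w = Zero C Z X" using z[OF add_arr[OF u w(1)]] by simp
  \<comment> \<open>The negative is only known on the right of \<open>v\<close>; cancelling
    \<open>v\<close> in front moves it to the left.\<close>
  have wv: "Add C w v = Zero C Z X"
  proof (rule add_cancel[OF v add_arr[OF w(1) v]])
    show "Zero C Z X \<Zcolon> Z \<rightarrow> X" using v arr_obj[OF v] by (simp add: zero_arr)
    show "Add C v (Add C w v) = Add C v (Zero C Z X)"
      using add_assoc[OF v w(1) v] w(2) zero_add[OF v] add_zero[OF v] by simp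
  qed
  show "u = v"
    using add_assoc[OF u w(1) v] uw wv zero_add[OF v] add_zero[OF u] by simp
qed

lemma monic_zero_cancel:
  assumes m: "monic C X Y m" and t: "t \<Zcolon> Z \<rightarrow> X" and z: "m \<cdot> t = Zero C Z Y"
  shows "t = Zero C Z X"
  using monic_cancel[OF m t zero_arr[OF arr_obj[OF t]]] z comp_zero[OF monic_arr[OF m] arr_obj(1)[OF t]]
  by simp

lemma is_kernel_arr: "is_kernel C X Y f K k \<Longrightarrow> k \<Zcolon> K \<rightarrow> X" "is_kernel C X Y f K k \<Longrightarrow> f \<Zcolon> X \<rightarrow> Y"
  by (auto simp: is_kernel_def arr_def)

lemma is_kernel_zero: "is_kernel C X Y f K k \<Longrightarrow> f \<cdot> k = Zero C K Y"
  by (auto simp: is_kernel_def)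

lemma is_kernel_lift:
  assumes "is_kernel C X Y f K k" "t \<Zcolon> Z \<rightarrow> X" "f \<cdot> t = Zero C Z Y"
  obtains u where "u \<Zcolon> Z \<rightarrow> K" "k \<cdot> u = t"
proof -
  have "K \<in> Obj C" using assms(1) by (simp add: is_kernel_def)
  moreover have "\<exists>!u. u \<in> Hom C Z K \<and> k \<cdot> u = t"
    using assms unfolding is_kernel_def arr_def by blast
  ultimately show thesis using that assms(2) by (auto simp: arr_def)
qed

text \<open>If \<open>k \<cdot> u = k \<cdot> v\<close>, both are factorizations of one map killed
  by \<open>f\<close>, and factorizations are unique.\<close>

lemma is_kernel_monic:
  assumes K: "is_kernel C X Y f K k"
  shows "monic C K X k"
proof -
  note k = is_kernel_arr(1)[OF K] and f = is_kernel_arr(2)[OF K]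
  have "u = v" if u: "u \<Zcolon> Z \<rightarrow> K" and v: "v \<Zcolon> Z \<rightarrow> K" and eq: "k \<cdot> u = k \<cdot> v" for Z u v
  proof -
    have "f \<cdot> (k \<cdot> u) = Zero C Z Y"
      using comp_assoc[OF f k u] is_kernel_zero[OF K] zero_comp[OF u arr_obj(2)[OF f]] by simp
    then have "\<exists>!w. w \<in> Hom C Z K \<and> k \<cdot> w = k \<cdot> u"
      using K comp_arr[OF k u] unfolding is_kernel_def arr_def by blast
    then show ?thesis using u v eq unfolding arr_def by metis
  qed
  then show ?thesis using k unfolding monic_def arr_def by blast
qed

subsection \<open>Sums of morphisms and biproducts\<close>

lemma hom_sum_empty:
  assumes "X \<in> Obj C" "Y \<in> Obj C"
  shows "hom_sum C X Y u {} = Zero C X Y"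
proof -
  interpret comm_group "hom_group C X Y" using hom_comm_group[OF assms] .
  show ?thesis by (simp add: hom_sum_def)
qed

lemma hom_sum_insert:
  assumes "X \<in> Obj C" "Y \<in> Obj C" "finite J" "j \<notin> J" "\<And>i. i \<in> insert j J \<Longrightarrow> u i \<Zcolon> X \<rightarrow> Y"
  shows "hom_sum C X Y u (insert j J) = Add C (u j) (hom_sum C X Y u J)"
proof -
  interpret comm_group "hom_group C X Y" using hom_comm_group[OF assms(1,2)] .
  show ?thesis using finprod_insert[of J j u] assms(3-5) by (auto simp: hom_sum_def arr_def)
qed

lemma hom_sum_arr:
  assumes "X \<in> Obj C" "Y \<in> Obj C" "\<And>i. i \<in> J \<Longrightarrow> u i \<Zcolon> X \<rightarrow> Y"
  shows "hom_sum C X Y u J \<Zcolon> X \<rightarrow> Y"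
proof -
  interpret comm_group "hom_group C X Y" using hom_comm_group[OF assms(1,2)] .
  show ?thesis using finprod_closed[of u J] assms by (auto simp: hom_sum_def arr_def)
qed

lemma hom_sum_cong:
  assumes "X \<in> Obj C" "Y \<in> Obj C" "\<And>i. i \<in> J \<Longrightarrow> v i \<Zcolon> X \<rightarrow> Y" "\<And>i. i \<in> J \<Longrightarrow> u i = v i"
  shows "hom_sum C X Y u J = hom_sum C X Y v J"
proof -
  interpret comm_group "hom_group C X Y" using hom_comm_group[OF assms(1,2)] .
  show ?thesis using finprod_cong'[of J J v u] assms(3,4) by (auto simp: hom_sum_def arr_def)
qed

lemma comp_hom_sum:
  assumes "finite J" and g: "g \<Zcolon> Y \<rightarrow> Z" and X: "X \<in> Obj C"
    and "\<And>i. i \<in> J \<Longrightarrow> u i \<Zcolon> X \<rightarrow> Y"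
  shows "g \<cdot> hom_sum C X Y u J = hom_sum C X Z (\<lambda>i. g \<cdot> u i) J"
  using assms(1,4)
proof (induction J rule: finite_induct)
  case empty
  then show ?case using comp_zero[OF g X] arr_obj[OF g] X by (simp add: hom_sum_empty)
next
  case (insert j J)
  note Y = arr_obj(1)[OF g] and Z = arr_obj(2)[OF g]
  have J: "hom_sum C X Y u J \<Zcolon> X \<rightarrow> Y" using insert.prems by (intro hom_sum_arr X Y) auto
  have "g \<cdot> hom_sum C X Y u (insert j J) = g \<cdot> Add C (u j) (hom_sum C X Y u J)"
    using hom_sum_insert[OF X Y insert.hyps(1,2)] insert.prems by simp
  also have "\<dots> = Add C (g \<cdot> u j) (g \<cdot> hom_sum C X Y u J)"
    using comp_add_right[OF g _ J] insert.prems by simp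
  also have "\<dots> = hom_sum C X Z (\<lambda>i. g \<cdot> u i) (insert j J)"
    using hom_sum_insert[OF X Z insert.hyps(1,2), of "\<lambda>i. g \<cdot> u i"] insert comp_arr[OF g] by simp
  finally show ?case .
qed

lemma hom_sum_comp:
  assumes "finite J" and g: "g \<Zcolon> W \<rightarrow> X" and Y: "Y \<in> Obj C"
    and "\<And>i. i \<in> J \<Longrightarrow> u i \<Zcolon> X \<rightarrow> Y"
  shows "hom_sum C X Y u J \<cdot> g = hom_sum C W Y (\<lambda>i. u i \<cdot> g) J"
  using assms(1,4)
proof (induction J rule: finite_induct)
  case empty
  then show ?case using zero_comp[OF g Y] arr_obj[OF g] Y by (simp add: hom_sum_empty)
next
  case (insert j J)
  note W = arr_obj(1)[OF g] and X = arr_obj(2)[OF g]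
  have J: "hom_sum C X Y u J \<Zcolon> X \<rightarrow> Y" using insert.prems by (intro hom_sum_arr X Y) auto
  have "hom_sum C X Y u (insert j J) \<cdot> g = Add C (u j) (hom_sum C X Y u J) \<cdot> g"
    using hom_sum_insert[OF X Y insert.hyps(1,2)] insert.prems by simp
  also have "\<dots> = Add C (u j \<cdot> g) (hom_sum C X Y u J \<cdot> g)"
    using comp_add_left[OF _ J g] insert.prems by simp
  also have "\<dots> = hom_sum C W Y (\<lambda>i. u i \<cdot> g) (insert j J)"
    using hom_sum_insert[OF W Y insert.hyps(1,2), of "\<lambda>i. u i \<cdot> g"] insert comp_arr[OF _ g] by simp
  finally show ?case .
qed

lemma hom_sum_zero:
  assumes "finite J" and X: "X \<in> Obj C" and Y: "Y \<in> Obj C"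
  shows "hom_sum C X Y (\<lambda>_. Zero C X Y) J = Zero C X Y"
  using assms(1)
proof (induction J rule: finite_induct)
  case (insert j J)
  show ?case
    using hom_sum_insert[OF X Y insert.hyps, of "\<lambda>_. Zero C X Y"] insert.IH zero_arr[OF X Y]
      add_zero[OF zero_arr[OF X Y]] by simp
qed (simp add: hom_sum_empty X Y)

lemma hom_sum_delta:
  assumes "finite J" "k \<in> J" and v: "v \<Zcolon> X \<rightarrow> Y"
  shows "hom_sum C X Y (\<lambda>j. if j = k then v else Zero C X Y) J = v"
proof -
  note X = arr_obj(1)[OF v] and Y = arr_obj(2)[OF v]
  let ?u = "\<lambda>j. if j = k then v else Zero C X Y"
  have "hom_sum C X Y ?u (insert k (J - {k})) = Add C v (hom_sum C X Y ?u (J - {k}))"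
    using assms(1) v zero_arr[OF X Y] by (subst hom_sum_insert[OF X Y]) auto
  moreover have "hom_sum C X Y ?u (J - {k}) = hom_sum C X Y (\<lambda>_. Zero C X Y) (J - {k})"
    using zero_arr[OF X Y] by (intro hom_sum_cong X Y) auto
  ultimately show ?thesis
    using hom_sum_zero[OF finite_Diff[OF assms(1)] X Y] assms(2) add_zero[OF v]
    by (simp add: insert_absorb)
qed

lemma is_biproductD:
  assumes "is_biproduct C J A S \<iota> \<pi>"
  shows "finite J" "S \<in> Obj C" "j \<in> J \<Longrightarrow> A j \<in> Obj C" "j \<in> J \<Longrightarrow> \<iota> j \<Zcolon> A j \<rightarrow> S"
    "j \<in> J \<Longrightarrow> \<pi> j \<Zcolon> S \<rightarrow> A j"
    "\<lbrakk>j \<in> J; k \<in> J\<rbrakk> \<Longrightarrow> \<pi> j \<cdot> \<iota> k = (if j = k then Ident C (A j) else Zero C (A k) (A j))"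
    "hom_sum C S S (\<lambda>j. \<iota> j \<cdot> \<pi> j) J = Ident C S"
  using assms by (auto simp: is_biproduct_def arr_def)

text \<open>Writing the identity of \<open>S\<close> as the sum of the
  \<open>\<iota> j \<cdot> \<pi> j\<close> recovers any map into \<open>S\<close> from its
  components. Nearly every equation between maps into \<open>S\<close>, \<open>G i S\<close> or
  \<open>G i (G j S)\<close> is checked this way.\<close>

lemma biproduct_proj_jointly_monic:
  assumes b: "is_biproduct C J A S \<iota> \<pi>" and f: "f \<Zcolon> Z \<rightarrow> S" and g: "g \<Zcolon> Z \<rightarrow> S"
    and eq: "\<And>j. j \<in> J \<Longrightarrow> \<pi> j \<cdot> f = \<pi> j \<cdot> g"
  shows "f = g"
proof -
  note b' = is_biproductD[OF b]
  have *: "t = hom_sum C Z S (\<lambda>j. \<iota> j \<cdot> (\<pi> j \<cdot> t)) J" if t: "t \<Zcolon> Z \<rightarrow> S" for t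
  proof -
    have "t = hom_sum C S S (\<lambda>j. \<iota> j \<cdot> \<pi> j) J \<cdot> t" using ident_comp[OF t] b'(7) by simp
    also have "\<dots> = hom_sum C Z S (\<lambda>j. (\<iota> j \<cdot> \<pi> j) \<cdot> t) J"
      using comp_arr[OF b'(4,5)] by (intro hom_sum_comp[OF b'(1) t b'(2)]) auto
    also have "\<dots> = hom_sum C Z S (\<lambda>j. \<iota> j \<cdot> (\<pi> j \<cdot> t)) J"
      using comp_assoc[OF b'(4) b'(5) t] comp_arr[OF b'(4) comp_arr[OF b'(5) t]]
      by (intro hom_sum_cong arr_obj[OF t]) auto
    finally show ?thesis .
  qed
  have "hom_sum C Z S (\<lambda>j. \<iota> j \<cdot> (\<pi> j \<cdot> f)) J = hom_sum C Z S (\<lambda>j. \<iota> j \<cdot> (\<pi> j \<cdot> g)) J"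
    using eq comp_arr[OF b'(4) comp_arr[OF b'(5) g]] by (intro hom_sum_cong arr_obj[OF f]) auto
  then show ?thesis using *[OF f] *[OF g] by simp
qed

lemma biproduct_inj_jointly_epic:
  assumes b: "is_biproduct C J A S \<iota> \<pi>" and f: "f \<Zcolon> S \<rightarrow> Z" and g: "g \<Zcolon> S \<rightarrow> Z"
    and eq: "\<And>j. j \<in> J \<Longrightarrow> f \<cdot> \<iota> j = g \<cdot> \<iota> j"
  shows "f = g"
proof -
  note b' = is_biproductD[OF b]
  have *: "t = hom_sum C S Z (\<lambda>j. (t \<cdot> \<iota> j) \<cdot> \<pi> j) J" if t: "t \<Zcolon> S \<rightarrow> Z" for t
  proof -
    have "t = t \<cdot> hom_sum C S S (\<lambda>j. \<iota> j \<cdot> \<pi> j) J" using comp_ident[OF t] b'(7) by simp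
    also have "\<dots> = hom_sum C S Z (\<lambda>j. t \<cdot> (\<iota> j \<cdot> \<pi> j)) J"
      using comp_arr[OF b'(4,5)] by (intro comp_hom_sum[OF b'(1) t b'(2)]) auto
    also have "\<dots> = hom_sum C S Z (\<lambda>j. (t \<cdot> \<iota> j) \<cdot> \<pi> j) J"
      using comp_assoc[OF t b'(4) b'(5)] comp_arr[OF comp_arr[OF t b'(4)] b'(5)]
      by (intro hom_sum_cong arr_obj[OF t]) auto
    finally show ?thesis .
  qed
  have "hom_sum C S Z (\<lambda>j. (f \<cdot> \<iota> j) \<cdot> \<pi> j) J = hom_sum C S Z (\<lambda>j. (g \<cdot> \<iota> j) \<cdot> \<pi> j) J"
    using eq comp_arr[OF comp_arr[OF g b'(4)] b'(5)] by (intro hom_sum_cong arr_obj[OF f]) auto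
  then show ?thesis using *[OF f] *[OF g] by simp
qed

lemma biproduct_lift:
  assumes b: "is_biproduct C J A S \<iota> \<pi>" and Z: "Z \<in> Obj C"
    and u: "\<And>j. j \<in> J \<Longrightarrow> u j \<Zcolon> Z \<rightarrow> A j"
  obtains h where "h \<Zcolon> Z \<rightarrow> S" "\<And>j. j \<in> J \<Longrightarrow> \<pi> j \<cdot> h = u j"
proof -
  note b' = is_biproductD[OF b]
  \<comment> \<open>Under \<open>\<pi> k\<close> all terms but the \<open>k\<close>-th vanish by
    orthogonality, leaving a sum handled by \<open>hom_sum_delta\<close>.\<close>
  let ?h = "hom_sum C Z S (\<lambda>j. \<iota> j \<cdot> u j) J"
  have iu: "\<iota> j \<cdot> u j \<Zcolon> Z \<rightarrow> S" if "j \<in> J" for j using comp_arr[OF b'(4) u] that by simp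
  have "\<pi> k \<cdot> ?h = u k" if k: "k \<in> J" for k
  proof -
    have "\<pi> k \<cdot> ?h = hom_sum C Z (A k) (\<lambda>j. \<pi> k \<cdot> (\<iota> j \<cdot> u j)) J"
      using comp_hom_sum[OF b'(1) b'(5)[OF k] Z iu] by simp
    also have "\<dots> = hom_sum C Z (A k) (\<lambda>j. if j = k then u k else Zero C Z (A k)) J"
    proof (rule hom_sum_cong[OF Z b'(3)[OF k]])
      fix j assume j: "j \<in> J"
      show "(if j = k then u k else Zero C Z (A k)) \<Zcolon> Z \<rightarrow> A k"
        using u[OF k] zero_arr[OF Z b'(3)[OF k]] by simp
      have "\<pi> k \<cdot> (\<iota> j \<cdot> u j) = (\<pi> k \<cdot> \<iota> j) \<cdot> u j"
        using comp_assoc[OF b'(5)[OF k] b'(4)[OF j] u[OF j]] by simp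
      then show "\<pi> k \<cdot> (\<iota> j \<cdot> u j) = (if j = k then u k else Zero C Z (A k))"
        using b'(6)[OF k j] ident_comp[OF u[OF k]] zero_comp[OF u[OF j] b'(3)[OF k]] by auto
    qed
    finally show ?thesis using hom_sum_delta[OF b'(1) k u[OF k]] by simp
  qed
  moreover have "?h \<Zcolon> Z \<rightarrow> S" using iu by (rule hom_sum_arr[OF Z b'(2)])
  ultimately show thesis using that by blast
qed

end

subsection \<open>Additive functors\<close>

lemma functor_arr:
  "\<lbrakk>is_functor C D F; f \<Zcolon>\<^bsub>C\<^esub> X \<rightarrow> Y\<rbrakk> \<Longrightarrow> amap F f \<Zcolon>\<^bsub>D\<^esub> omap F X \<rightarrow> omap F Y"
  by (auto simp: is_functor_def arr_def)

lemma functor_ident: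
  "\<lbrakk>is_functor C D F; X \<in> Obj C\<rbrakk> \<Longrightarrow> amap F (Ident C X) = Ident D (omap F X)"
  by (auto simp: is_functor_def)

lemma functor_comp:
  "\<lbrakk>is_functor C D F; g \<Zcolon>\<^bsub>C\<^esub> Y \<rightarrow> Z; f \<Zcolon>\<^bsub>C\<^esub> X \<rightarrow> Y\<rbrakk>
    \<Longrightarrow> amap F (g \<cdot>\<^bsub>C\<^esub> f) = amap F g \<cdot>\<^bsub>D\<^esub> amap F f"
  unfolding is_functor_def arr_def by blast

lemma additive_functor_is_functor: "additive_functor C D F \<Longrightarrow> is_functor C D F"
  by (simp add: additive_functor_def)

lemma additive_functor_add:
  "\<lbrakk>additive_functor C D F; f \<Zcolon>\<^bsub>C\<^esub> X \<rightarrow> Y; g \<Zcolon>\<^bsub>C\<^esub> X \<rightarrow> Y\<rbrakk>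
    \<Longrightarrow> amap F (Add C f g) = Add D (amap F f) (amap F g)"
  unfolding additive_functor_def arr_def by blast

locale preadditive_functor = C: preadditive_category C + D: preadditive_category D
  for C :: "('o, 'm, 'z) preadd_category_scheme" and D :: "('p, 'q, 'w) preadd_category_scheme" +
  fixes F :: "('o, 'm, 'p, 'q) functor_data"
  assumes additive: "additive_functor C D F"
begin

lemmas F_arr = functor_arr[OF additive_functor_is_functor[OF additive]]
lemmas F_ident = functor_ident[OF additive_functor_is_functor[OF additive]]
lemmas F_comp = functor_comp[OF additive_functor_is_functor[OF additive]]

lemma F_obj: "X \<in> Obj C \<Longrightarrow> omap F X \<in> Obj D"
  using additive by (simp add: additive_functor_def is_functor_def)

lemma F_zero:
  assumes "X \<in> Obj C" "Y \<in> Obj C"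
  shows "amap F (Zero C X Y) = Zero D (omap F X) (omap F Y)"
proof -
  note z = C.zero_arr[OF assms]
  show ?thesis
    using D.add_idem_zero[OF F_arr[OF z]] additive_functor_add[OF additive z z] C.add_zero[OF z]
    by simp
qed

lemma F_hom_sum:
  assumes "finite J" and X: "X \<in> Obj C" and Y: "Y \<in> Obj C"
    and "\<And>j. j \<in> J \<Longrightarrow> u j \<Zcolon>\<^bsub>C\<^esub> X \<rightarrow> Y"
  shows "amap F (hom_sum C X Y u J) = hom_sum D (omap F X) (omap F Y) (\<lambda>j. amap F (u j)) J"
  using assms(1,4)
proof (induction J rule: finite_induct)
  case empty
  then show ?case using X Y by (simp add: C.hom_sum_empty D.hom_sum_empty F_zero F_obj)
next
  case (insert j J)
  have J: "hom_sum C X Y u J \<Zcolon>\<^bsub>C\<^esub> X \<rightarrow> Y" using insert.prems by (intro C.hom_sum_arr X Y) auto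
  have "amap F (hom_sum C X Y u (insert j J)) = amap F (Add C (u j) (hom_sum C X Y u J))"
    using C.hom_sum_insert[OF X Y insert.hyps] insert.prems by simp
  also have "\<dots> = Add D (amap F (u j)) (amap F (hom_sum C X Y u J))"
    using additive_functor_add[OF additive _ J] insert.prems by simp
  also have "\<dots> = hom_sum D (omap F X) (omap F Y) (\<lambda>j. amap F (u j)) (insert j J)"
    using D.hom_sum_insert[OF F_obj[OF X] F_obj[OF Y] insert.hyps, of "\<lambda>j. amap F (u j)"] insert
      F_arr by simp
  finally show ?case .
qed

text \<open>A biproduct is given by equations in composition, sum, identity and zero, all of which
  an additive functor respects. Applied once or twice, it lets maps into \<open>G i S\<close> or
  \<open>G i (G j S)\<close> be compared by components.\<close>

lemma F_biproduct:
  assumes b: "is_biproduct C J A S \<iota> \<pi>"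
  shows "is_biproduct D J (\<lambda>j. omap F (A j)) (omap F S) (\<lambda>j. amap F (\<iota> j)) (\<lambda>j. amap F (\<pi> j))"
proof -
  note b' = C.is_biproductD[OF b]
  have orth: "amap F (\<pi> j) \<cdot>\<^bsub>D\<^esub> amap F (\<iota> k) =
      (if j = k then Ident D (omap F (A j)) else Zero D (omap F (A k)) (omap F (A j)))"
    if "j \<in> J" "k \<in> J" for j k
    using F_comp[OF b'(5) b'(4), OF that] b'(6)[OF that] that b'(3) F_ident F_zero by auto
  have "hom_sum D (omap F S) (omap F S) (\<lambda>j. amap F (\<iota> j) \<cdot>\<^bsub>D\<^esub> amap F (\<pi> j)) J
      = hom_sum D (omap F S) (omap F S) (\<lambda>j. amap F (\<iota> j \<cdot>\<^bsub>C\<^esub> \<pi> j)) J"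
    using F_comp[OF b'(4) b'(5)] F_arr[OF C.comp_arr[OF b'(4) b'(5)]]
    by (intro D.hom_sum_cong F_obj b'(2)) auto
  also have "\<dots> = amap F (hom_sum C S S (\<lambda>j. \<iota> j \<cdot>\<^bsub>C\<^esub> \<pi> j) J)"
    using C.comp_arr[OF b'(4) b'(5)] by (intro F_hom_sum[symmetric] b'(1,2)) auto
  also have "\<dots> = Ident D (omap F S)"
    using b'(2,7) F_ident by simp
  finally show ?thesis
    using orth F_arr[OF b'(4)] F_arr[OF b'(5)] b'(1,2,3) F_obj unfolding is_biproduct_def
    by (auto simp: arr_def)
qed

end

section \<open>Abelian categories\<close>

context abelian_category
begin

lemma ex_biproduct:
  assumes "finite J" "\<And>j. j \<in> J \<Longrightarrow> A j \<in> Obj C"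
  shows "\<exists>S \<iota> \<pi>. is_biproduct C J A S \<iota> \<pi>"
  using assms
proof (induction J rule: finite_induct)
  case empty
  obtain Z where Z: "zero_object C Z" using ex_zero_object by blast
  then have Zo: "Z \<in> Obj C" by (simp add: zero_object_def)
  then have "Zero C Z Z \<in> Hom C Z Z" "Ident C Z \<in> Hom C Z Z"
    using zero_arr Ident_in_Hom by (auto simp: arr_def)
  \<comment> \<open>The empty sum is zero, so the zero object is an empty biproduct exactly because
    its identity is zero.\<close>
  then have "Zero C Z Z = Ident C Z" using Z Zo unfolding zero_object_def by blast
  then show ?case using Zo by (auto simp: is_biproduct_def hom_sum_empty)
next
  case (insert j J)
  then obtain S \<iota> \<pi> where b: "is_biproduct C J A S \<iota> \<pi>" by auto
  note b' = is_biproductD[OF b]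
  have Aj: "A j \<in> Obj C" using insert.prems by simp
  obtain T i1 i2 p1 p2 where "is_biproduct2 C (A j) S T i1 i2 p1 p2"
    using ex_biproduct2[OF Aj b'(2)] by blast
  then have i1: "i1 \<Zcolon> A j \<rightarrow> T" and i2: "i2 \<Zcolon> S \<rightarrow> T" and p1: "p1 \<Zcolon> T \<rightarrow> A j" and p2: "p2 \<Zcolon> T \<rightarrow> S"
    and pi: "p1 \<cdot> i1 = Ident C (A j)" "p2 \<cdot> i2 = Ident C S" "p1 \<cdot> i2 = Zero C S (A j)"
      "p2 \<cdot> i1 = Zero C (A j) S" "Add C (i1 \<cdot> p1) (i2 \<cdot> p2) = Ident C T"
    by (auto simp: is_biproduct2_def arr_def)
  note T = arr_obj(2)[OF i1]
  \<comment> \<open>The old summands reach \<open>T\<close> through the second factor of the binary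
    biproduct of \<open>A j\<close> and \<open>S\<close>.\<close>
  define \<iota>' where "\<iota>' k = (if k = j then i1 else i2 \<cdot> \<iota> k)" for k
  define \<pi>' where "\<pi>' k = (if k = j then p1 else \<pi> k \<cdot> p2)" for k
  have \<iota>': "\<iota>' k \<Zcolon> A k \<rightarrow> T" and \<pi>': "\<pi>' k \<Zcolon> T \<rightarrow> A k" if "k \<in> insert j J" for k
    using that i1 p1 comp_arr[OF i2 b'(4)] comp_arr[OF b'(5) p2] by (auto simp: \<iota>'_def \<pi>'_def)
  have eqJ: "\<iota>' k = i2 \<cdot> \<iota> k" "\<pi>' k = \<pi> k \<cdot> p2" if "k \<in> J" for k
    using that insert.hyps by (auto simp: \<iota>'_def \<pi>'_def)
  have "\<pi>' k \<cdot> \<iota>' l = (if k = l then Ident C (A k) else Zero C (A l) (A k))"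
    if k: "k \<in> insert j J" and l: "l \<in> insert j J" for k l
  proof -
    consider "k = j" "l = j" | "k = j" "l \<noteq> j" "l \<in> J" | "k \<noteq> j" "k \<in> J" "l = j"
      | "k \<noteq> j" "k \<in> J" "l \<noteq> j" "l \<in> J" using k l by blast
    then show ?thesis
    proof cases
      case 1
      then show ?thesis using pi(1) by (simp add: \<iota>'_def \<pi>'_def)
    next
      case 2
      then show ?thesis
        using comp_assoc[OF p1 i2 b'(4)[of l]] pi(3) zero_comp[OF b'(4)[of l] Aj]
        by (simp add: \<iota>'_def \<pi>'_def)
    next
      case 3
      then show ?thesis
        using comp_assoc[OF b'(5)[of k] p2 i1] pi(4) comp_zero[OF b'(5)[of k] Aj]
        by (simp add: \<iota>'_def \<pi>'_def)
    next
      case 4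
      have "\<pi>' k \<cdot> \<iota>' l = \<pi> k \<cdot> ((p2 \<cdot> i2) \<cdot> \<iota> l)"
        using 4 comp_assoc[OF b'(5)[of k] p2 comp_arr[OF i2 b'(4)[of l]]]
          comp_assoc[OF p2 i2 b'(4)[of l]] by (simp add: eqJ)
      then show ?thesis using 4 pi(2) ident_comp[OF b'(4)[of l]] b'(6)[of k l] by simp
    qed
  qed
  moreover have "hom_sum C T T (\<lambda>k. \<iota>' k \<cdot> \<pi>' k) (insert j J) = Ident C T"
  proof -
    have "hom_sum C T T (\<lambda>k. \<iota>' k \<cdot> \<pi>' k) J = hom_sum C T T (\<lambda>k. i2 \<cdot> ((\<iota> k \<cdot> \<pi> k) \<cdot> p2)) J"
    proof (rule hom_sum_cong[OF T T])
      fix k assume k: "k \<in> J"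
      note ip = comp_arr[OF b'(4)[OF k] b'(5)[OF k]]
      show "i2 \<cdot> ((\<iota> k \<cdot> \<pi> k) \<cdot> p2) \<Zcolon> T \<rightarrow> T" using comp_arr[OF i2 comp_arr[OF ip p2]] .
      show "\<iota>' k \<cdot> \<pi>' k = i2 \<cdot> ((\<iota> k \<cdot> \<pi> k) \<cdot> p2)"
        using comp_assoc[OF i2 b'(4)[OF k] comp_arr[OF b'(5)[OF k] p2]]
          comp_assoc[OF b'(4)[OF k] b'(5)[OF k] p2] k by (simp add: eqJ)
    qed
    also have "\<dots> = i2 \<cdot> hom_sum C T S (\<lambda>k. (\<iota> k \<cdot> \<pi> k) \<cdot> p2) J"
      using comp_arr[OF comp_arr[OF b'(4) b'(5)] p2]
      by (intro comp_hom_sum[OF b'(1) i2 T, symmetric]) auto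
    also have "hom_sum C T S (\<lambda>k. (\<iota> k \<cdot> \<pi> k) \<cdot> p2) J = hom_sum C S S (\<lambda>k. \<iota> k \<cdot> \<pi> k) J \<cdot> p2"
      using comp_arr[OF b'(4) b'(5)] by (intro hom_sum_comp[OF b'(1) p2 b'(2), symmetric]) auto
    also have "\<dots> = p2" using b'(7) ident_comp[OF p2] by simp
    finally have "hom_sum C T T (\<lambda>k. \<iota>' k \<cdot> \<pi>' k) J = i2 \<cdot> p2" .
    moreover have "hom_sum C T T (\<lambda>k. \<iota>' k \<cdot> \<pi>' k) (insert j J)
        = Add C (\<iota>' j \<cdot> \<pi>' j) (hom_sum C T T (\<lambda>k. \<iota>' k \<cdot> \<pi>' k) J)"
      by (rule hom_sum_insert[OF T T insert.hyps]) (rule comp_arr[OF \<iota>' \<pi>'])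
    ultimately show ?thesis using pi(5) by (simp add: \<iota>'_def \<pi>'_def)
  qed
  ultimately have "is_biproduct C (insert j J) A T \<iota>' \<pi>'"
    using insert.hyps insert.prems T \<iota>' \<pi>' unfolding is_biproduct_def arr_def by auto
  then show ?case by blast
qed

lemma dsum_is_biproduct:
  assumes "finite J" "\<And>j. j \<in> J \<Longrightarrow> A j \<in> Obj C"
  shows "is_biproduct C J A (dsum_obj C J A) (dsum_inj C J A) (dsum_proj C J A)"
proof -
  have "\<exists>x. case x of (S, \<iota>, \<pi>) \<Rightarrow> is_biproduct C J A S \<iota> \<pi>" using ex_biproduct[OF assms] by auto
  from someI_ex[OF this] show ?thesis
    by (simp add: dsum_obj_def dsum_inj_def dsum_proj_def dsum_def case_prod_unfold)
qed

lemma kernel_obj_is_kernel: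
  assumes "f \<Zcolon> X \<rightarrow> Y"
  obtains k where "is_kernel C X Y f (kernel_obj C X Y f) k"
proof -
  have "\<exists>x. case x of (K, k) \<Rightarrow> is_kernel C X Y f K k"
    using ex_kernel[of X Y f] assms by (auto simp: arr_def)
  from someI_ex[OF this] show thesis using that by (simp add: kernel_obj_def case_prod_unfold)
qed

text \<open>In an abelian category a monomorphism is a kernel; left exactness preserves kernels, and
  kernels are monic.\<close>

lemma left_exact_functor_monic:
  assumes F: "left_exact_functor C D F" and D: "preadditive_category D" and m: "monic C X Y m"
  shows "monic D (omap F X) (omap F Y) (amap F m)"
proof -
  obtain Z f where "is_kernel C Y Z f X m" using monic_is_kernel[OF m] by blast
  then have "is_kernel D (omap F Y) (omap F Z) (amap F f) (omap F X) (amap F m)"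
    using F unfolding left_exact_functor_def by blast
  then show ?thesis by (rule preadditive_category.is_kernel_monic[OF D])
qed

end

section \<open>Trivial extensions\<close>

locale left_trivial_extension = abelian_category C
  for C :: "('o, 'm, 'z) preadd_category_scheme" (structure) +
  fixes n :: nat and G :: "nat \<Rightarrow> ('o, 'm) endofunctor_data" and \<Psi> :: "nat \<Rightarrow> nat \<Rightarrow> 'o \<Rightarrow> 'm"
  assumes G_additive: "i \<in> {1..n} \<Longrightarrow> additive_functor C C (G i)"
    and G_left_exact: "i \<in> {1..n} \<Longrightarrow> left_exact_functor C C (G i)"
    and natural: "natural_family C n G \<Psi>"
    and coassoc: "coassociative C n G \<Psi>"
begin

section \<open>Passage between the extension and the base category\<close>

abbreviation ext ("\<E>") where "\<E> \<equiv> trivial_extension C n G \<Psi>"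

lemma G_preadditive_functor: "i \<in> {1..n} \<Longrightarrow> preadditive_functor C C (G i)"
  by (simp add: preadditive_functor_def preadditive_functor_axioms_def G_additive
      preadditive_category_axioms)

lemmas G_obj = preadditive_functor.F_obj[OF G_preadditive_functor]
lemmas G_arr = preadditive_functor.F_arr[OF G_preadditive_functor]
lemmas G_ident = preadditive_functor.F_ident[OF G_preadditive_functor]
lemmas G_comp = preadditive_functor.F_comp[OF G_preadditive_functor]
lemmas G_zero = preadditive_functor.F_zero[OF G_preadditive_functor]
lemmas G_biproduct = preadditive_functor.F_biproduct[OF G_preadditive_functor]
lemmas G_monic = left_exact_functor_monic[OF G_left_exact preadditive_category_axioms]

lemma \<Psi>_arr:
  "\<lbrakk>i \<in> {1..n}; j \<in> {1..n}; i + j \<le> n; X \<in> Obj C\<rbrakk>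
    \<Longrightarrow> \<Psi> i j X \<Zcolon> omap (G (i + j)) X \<rightarrow> omap (G i) (omap (G j) X)"
  using natural G_obj[of "i + j" X] G_obj[of j X] G_obj[of i "omap (G j) X"]
  by (auto simp: natural_family_def natural_transformation_def functor_comp_def arr_def)

lemma \<Psi>_natural:
  assumes "i \<in> {1..n}" "j \<in> {1..n}" "i + j \<le> n" "f \<Zcolon> X \<rightarrow> Y"
  shows "\<Psi> i j Y \<cdot> amap (G (i + j)) f = amap (G i) (amap (G j) f) \<cdot> \<Psi> i j X"
proof -
  have "natural_transformation C C (G (i + j)) (functor_comp (G i) (G j)) (\<Psi> i j)"
    using natural assms(1-3) by (simp add: natural_family_def)
  then show ?thesis
    using assms(4) by (simp add: natural_transformation_def functor_comp_def arr_def)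
qed

lemma \<Psi>_coassoc:
  "\<lbrakk>i \<in> {1..n}; j \<in> {1..n}; k \<in> {1..n}; i + j + k \<le> n; X \<in> Obj C\<rbrakk>
    \<Longrightarrow> amap (G i) (\<Psi> j k X) \<cdot> \<Psi> i (j + k) X = \<Psi> i j (omap (G k) X) \<cdot> \<Psi> (i + j) k X"
  using coassoc by (simp add: coassociative_def)

lemma ext_simps [simp]:
  "Comp \<E> = Comp C" "Add \<E> = Add C" "Ident \<E> (X, \<alpha>) = Ident C X"
  "Zero \<E> (X, \<alpha>) (Y, \<beta>) = Zero C X Y"
  by (auto simp: trivial_extension_def)

lemma ext_objI:
  assumes "X \<in> Obj C" "\<alpha> \<in> extensional {1..n}"
    and "\<And>i. i \<in> {1..n} \<Longrightarrow> \<alpha> i \<Zcolon> X \<rightarrow> omap (G i) X"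
    and "\<And>i j. \<lbrakk>i \<in> {1..n}; j \<in> {1..n}; i + j \<le> n\<rbrakk>
      \<Longrightarrow> amap (G i) (\<alpha> j) \<cdot> \<alpha> i = \<Psi> i j X \<cdot> \<alpha> (i + j)"
    and "\<And>i j. \<lbrakk>i \<in> {1..n}; j \<in> {1..n}; \<not> i + j \<le> n\<rbrakk>
      \<Longrightarrow> amap (G i) (\<alpha> j) \<cdot> \<alpha> i = Zero C X (omap (G i) (omap (G j) X))"
  shows "(X, \<alpha>) \<in> Obj \<E>"
proof -
  have "\<alpha> \<in> (\<Pi>\<^sub>E i\<in>{1..n}. Hom C X (omap (G i) X))"
    using assms(2,3) by (auto simp: PiE_def arr_def)
  then show ?thesis using assms(1,4,5) by (simp add: trivial_extension_def)
qed

lemma ext_objD: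
  assumes "(X, \<alpha>) \<in> Obj \<E>"
  shows "X \<in> Obj C" "i \<in> {1..n} \<Longrightarrow> \<alpha> i \<Zcolon> X \<rightarrow> omap (G i) X"
    "\<lbrakk>i \<in> {1..n}; j \<in> {1..n}; i + j \<le> n\<rbrakk> \<Longrightarrow> amap (G i) (\<alpha> j) \<cdot> \<alpha> i = \<Psi> i j X \<cdot> \<alpha> (i + j)"
    "\<lbrakk>i \<in> {1..n}; j \<in> {1..n}; \<not> i + j \<le> n\<rbrakk>
      \<Longrightarrow> amap (G i) (\<alpha> j) \<cdot> \<alpha> i = Zero C X (omap (G i) (omap (G j) X))"
  using assms G_obj by (auto simp: trivial_extension_def arr_def)

lemma ext_arr_iff:
  "\<gamma> \<Zcolon>\<^bsub>\<E>\<^esub> (X, \<alpha>) \<rightarrow> (Y, \<beta>) \<longleftrightarrow> (X, \<alpha>) \<in> Obj \<E> \<and> (Y, \<beta>) \<in> Obj \<E> \<and> \<gamma> \<Zcolon> X \<rightarrow> Y \<and>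
     (\<forall>i \<in> {1..n}. \<beta> i \<cdot> \<gamma> = amap (G i) \<gamma> \<cdot> \<alpha> i)"
  by (auto simp: arr_def trivial_extension_def)

lemma ext_arrD:
  assumes "\<gamma> \<Zcolon>\<^bsub>\<E>\<^esub> (X, \<alpha>) \<rightarrow> (Y, \<beta>)"
  shows "(X, \<alpha>) \<in> Obj \<E>" "(Y, \<beta>) \<in> Obj \<E>" "\<gamma> \<Zcolon> X \<rightarrow> Y"
    "i \<in> {1..n} \<Longrightarrow> \<beta> i \<cdot> \<gamma> = amap (G i) \<gamma> \<cdot> \<alpha> i"
  using assms by (auto simp: ext_arr_iff)

lemma ext_ident_arr:
  assumes X: "(X, \<alpha>) \<in> Obj \<E>"
  shows "Ident C X \<Zcolon>\<^bsub>\<E>\<^esub> (X, \<alpha>) \<rightarrow> (X, \<alpha>)"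
  using X ext_objD[OF X] comp_ident[OF ext_objD(2)[OF X]] ident_comp[OF ext_objD(2)[OF X]]
    ident_arr[of X] G_ident[of _ X] by (auto simp: ext_arr_iff)

lemma ext_comp_arr:
  assumes g: "\<gamma>' \<Zcolon>\<^bsub>\<E>\<^esub> (Y, \<beta>) \<rightarrow> (Z, \<zeta>)" and f: "\<gamma> \<Zcolon>\<^bsub>\<E>\<^esub> (X, \<alpha>) \<rightarrow> (Y, \<beta>)"
  shows "\<gamma>' \<cdot> \<gamma> \<Zcolon>\<^bsub>\<E>\<^esub> (X, \<alpha>) \<rightarrow> (Z, \<zeta>)"
  unfolding ext_arr_iff
proof (intro conjI ballI)
  note g' = ext_arrD[OF g] and f' = ext_arrD[OF f]
  show "(X, \<alpha>) \<in> Obj \<E>" "(Z, \<zeta>) \<in> Obj \<E>" "\<gamma>' \<cdot> \<gamma> \<Zcolon> X \<rightarrow> Z"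
    using f'(1) g'(2) comp_arr[OF g'(3) f'(3)] by auto
  fix i assume i: "i \<in> {1..n}"
  note \<alpha> = ext_objD(2)[OF f'(1) i] and \<beta> = ext_objD(2)[OF f'(2) i] and \<zeta> = ext_objD(2)[OF g'(2) i]
  note G\<gamma> = G_arr[OF i f'(3)] and G\<gamma>' = G_arr[OF i g'(3)]
  have "\<zeta> i \<cdot> (\<gamma>' \<cdot> \<gamma>) = (amap (G i) \<gamma>' \<cdot> \<beta> i) \<cdot> \<gamma>"
    using comp_assoc[OF \<zeta> g'(3) f'(3)] g'(4)[OF i] by simp
  also have "\<dots> = amap (G i) \<gamma>' \<cdot> (amap (G i) \<gamma> \<cdot> \<alpha> i)"
    using comp_assoc[OF G\<gamma>' \<beta> f'(3)] f'(4)[OF i] by simp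
  also have "\<dots> = amap (G i) (\<gamma>' \<cdot> \<gamma>) \<cdot> \<alpha> i"
    using comp_assoc[OF G\<gamma>' G\<gamma> \<alpha>] G_comp[OF i g'(3) f'(3)] by simp
  finally show "\<zeta> i \<cdot> (\<gamma>' \<cdot> \<gamma>) = amap (G i) (\<gamma>' \<cdot> \<gamma>) \<cdot> \<alpha> i" .
qed

text \<open>The laws are inherited from the base because composition and identities are the same;
  this makes \<open>injective_retract\<close> available in the extension.\<close>

lemma is_category_ext: "is_category \<E>"
proof
  fix X assume "X \<in> Obj \<E>"
  then show "Ident \<E> X \<in> Hom \<E> X X"
    using ext_ident_arr[of "fst X" "snd X"] by (cases X) (simp add: arr_def)
next
  fix X Y Z f g assume "X \<in> Obj \<E>" "Y \<in> Obj \<E>" "Z \<in> Obj \<E>" "f \<in> Hom \<E> X Y" "g \<in> Hom \<E> Y Z"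
  then show "g \<cdot>\<^bsub>\<E>\<^esub> f \<in> Hom \<E> X Z"
    using ext_comp_arr[of g "fst Y" "snd Y" "fst Z" "snd Z" f "fst X" "snd X"] by (simp add: arr_def)
next
  fix X Y f assume "X \<in> Obj \<E>" "Y \<in> Obj \<E>" "f \<in> Hom \<E> X Y"
  then have "f \<Zcolon> fst X \<rightarrow> fst Y"
    using ext_arrD(3)[of f "fst X" "snd X" "fst Y" "snd Y"] by (simp add: arr_def)
  then show "f \<cdot>\<^bsub>\<E>\<^esub> Ident \<E> X = f" "Ident \<E> Y \<cdot>\<^bsub>\<E>\<^esub> f = f"
    using comp_ident[of f] ident_comp[of f] by (cases X; cases Y; simp)+
next
  fix W X Y Z f g h
  assume "W \<in> Obj \<E>" "X \<in> Obj \<E>" "Y \<in> Obj \<E>" "Z \<in> Obj \<E>"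
    "f \<in> Hom \<E> W X" "g \<in> Hom \<E> X Y" "h \<in> Hom \<E> Y Z"
  then have "f \<Zcolon> fst W \<rightarrow> fst X" "g \<Zcolon> fst X \<rightarrow> fst Y" "h \<Zcolon> fst Y \<rightarrow> fst Z"
    using ext_arrD(3)[of f "fst W" "snd W" "fst X" "snd X"]
      ext_arrD(3)[of g "fst X" "snd X" "fst Y" "snd Y"]
      ext_arrD(3)[of h "fst Y" "snd Y" "fst Z" "snd Z"] by (simp_all add: arr_def)
  then show "(h \<cdot>\<^bsub>\<E>\<^esub> g) \<cdot>\<^bsub>\<E>\<^esub> f = h \<cdot>\<^bsub>\<E>\<^esub> g \<cdot>\<^bsub>\<E>\<^esub> f"
    using comp_assoc by simp
qed

subsection \<open>Kernels and monomorphisms\<close>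

text \<open>Compatibility of \<open>u\<close> with the structure maps may be tested after composing
  with \<open>amap (G i) k\<close>, which is monic; there it follows from compatibility of
  \<open>k\<close> and of \<open>k \<cdot> u\<close>.\<close>

lemma ext_arr_factor:
  assumes k: "k \<Zcolon>\<^bsub>\<E>\<^esub> (L, l) \<rightarrow> (X, \<alpha>)" and mk: "monic C L X k"
    and ku: "k \<cdot> u \<Zcolon>\<^bsub>\<E>\<^esub> (Z, \<zeta>) \<rightarrow> (X, \<alpha>)" and u: "u \<Zcolon> Z \<rightarrow> L"
  shows "u \<Zcolon>\<^bsub>\<E>\<^esub> (Z, \<zeta>) \<rightarrow> (L, l)"
  unfolding ext_arr_iff
proof (intro conjI ballI)
  note k' = ext_arrD[OF k] and t' = ext_arrD[OF ku]
  show "(Z, \<zeta>) \<in> Obj \<E>" "(L, l) \<in> Obj \<E>" "u \<Zcolon> Z \<rightarrow> L" using t'(1) k'(1) u by auto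
  fix i assume i: "i \<in> {1..n}"
  note \<zeta> = ext_objD(2)[OF t'(1) i] and l = ext_objD(2)[OF k'(1) i] and \<alpha> = ext_objD(2)[OF k'(2) i]
  note Gk = G_arr[OF i k'(3)] and Gu = G_arr[OF i u]
  have "amap (G i) k \<cdot> (l i \<cdot> u) = (\<alpha> i \<cdot> k) \<cdot> u"
    using comp_assoc[OF Gk l u] k'(4)[OF i] by simp
  also have "\<dots> = amap (G i) (k \<cdot> u) \<cdot> \<zeta> i"
    using comp_assoc[OF \<alpha> k'(3) u] t'(4)[OF i] by simp
  also have "\<dots> = amap (G i) k \<cdot> (amap (G i) u \<cdot> \<zeta> i)"
    using G_comp[OF i k'(3) u] comp_assoc[OF Gk Gu \<zeta>] by simp
  finally show "l i \<cdot> u = amap (G i) u \<cdot> \<zeta> i"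
    using monic_cancel[OF G_monic[OF i mk]] comp_arr[OF l u] comp_arr[OF Gu \<zeta>] by blast
qed

text \<open>The base kernel inherits a structure: \<open>\<alpha> i \<cdot> k\<close> is killed by
  \<open>amap (G i) \<gamma>\<close>, whose kernel is \<open>amap (G i) k\<close> by left exactness.
  The kernel property is kept in the base category, where vanishing is later tested.\<close>

lemma ext_kernel:
  assumes \<gamma>: "\<gamma> \<Zcolon>\<^bsub>\<E>\<^esub> (X, \<alpha>) \<rightarrow> (Y, \<beta>)"
  obtains L l k where "is_kernel C X Y \<gamma> L k" "k \<Zcolon>\<^bsub>\<E>\<^esub> (L, l) \<rightarrow> (X, \<alpha>)"
proof -
  note \<gamma>' = ext_arrD[OF \<gamma>]
  obtain L k where K: "is_kernel C X Y \<gamma> L k"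
    using ex_kernel \<gamma>'(3) unfolding arr_def by blast
  note k = is_kernel_arr(1)[OF K]
  note L = arr_obj(1)[OF k]
  have "\<exists>u. u \<Zcolon> L \<rightarrow> omap (G i) L \<and> amap (G i) k \<cdot> u = \<alpha> i \<cdot> k" if i: "i \<in> {1..n}" for i
  proof -
    note \<alpha> = ext_objD(2)[OF \<gamma>'(1) i] and \<beta> = ext_objD(2)[OF \<gamma>'(2) i]
    have GK: "is_kernel C (omap (G i) X) (omap (G i) Y) (amap (G i) \<gamma>) (omap (G i) L) (amap (G i) k)"
      using G_left_exact[OF i] K by (simp add: left_exact_functor_def)
    have "amap (G i) \<gamma> \<cdot> (\<alpha> i \<cdot> k) = \<beta> i \<cdot> (\<gamma> \<cdot> k)"
      using comp_assoc[OF G_arr[OF i \<gamma>'(3)] \<alpha> k] comp_assoc[OF \<beta> \<gamma>'(3) k] \<gamma>'(4)[OF i] by simp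
    also have "\<dots> = Zero C L (omap (G i) Y)"
      using is_kernel_zero[OF K] comp_zero[OF \<beta> L] by simp
    finally show ?thesis using is_kernel_lift[OF GK comp_arr[OF \<alpha> k]] by blast
  qed
  then obtain l0 where l0: "\<And>i. i \<in> {1..n} \<Longrightarrow> l0 i \<Zcolon> L \<rightarrow> omap (G i) L \<and> amap (G i) k \<cdot> l0 i = \<alpha> i \<cdot> k"
    by metis
  define l where "l = restrict l0 {1..n}"
  have l: "l i \<Zcolon> L \<rightarrow> omap (G i) L" and kl: "amap (G i) k \<cdot> l i = \<alpha> i \<cdot> k" if "i \<in> {1..n}" for i
    using l0[OF that] that by (auto simp: l_def)
  \<comment> \<open>Carries the double structure composite of \<open>L\<close> over to that of
    \<open>X\<close>, where the equations of an object are known.\<close>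
  have *: "amap (G i) (amap (G j) k) \<cdot> (amap (G i) (l j) \<cdot> l i) = (amap (G i) (\<alpha> j) \<cdot> \<alpha> i) \<cdot> k"
    if i: "i \<in> {1..n}" and j: "j \<in> {1..n}" for i j
  proof -
    note Gk = G_arr[OF j k]
    note \<alpha>i = ext_objD(2)[OF \<gamma>'(1) i] and \<alpha>j = ext_objD(2)[OF \<gamma>'(1) j]
    have "amap (G i) (amap (G j) k) \<cdot> (amap (G i) (l j) \<cdot> l i) = amap (G i) (amap (G j) k \<cdot> l j) \<cdot> l i"
      using comp_assoc[OF G_arr[OF i Gk] G_arr[OF i l[OF j]] l[OF i]] G_comp[OF i Gk l[OF j]] by simp
    also have "\<dots> = amap (G i) (\<alpha> j) \<cdot> (amap (G i) k \<cdot> l i)"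
      using kl[OF j] G_comp[OF i \<alpha>j k] comp_assoc[OF G_arr[OF i \<alpha>j] G_arr[OF i k] l[OF i]] by simp
    also have "\<dots> = (amap (G i) (\<alpha> j) \<cdot> \<alpha> i) \<cdot> k"
      using kl[OF i] comp_assoc[OF G_arr[OF i \<alpha>j] \<alpha>i k] by simp
    finally show ?thesis .
  qed
  \<comment> \<open>This permits cancelling the doubly applied inclusion, so the equations for
    \<open>\<alpha>\<close> descend to \<open>l\<close>.\<close>
  have mono: "monic C (omap (G i) (omap (G j) L)) (omap (G i) (omap (G j) X)) (amap (G i) (amap (G j) k))"
    if "i \<in> {1..n}" "j \<in> {1..n}" for i j
    using G_monic[OF that(1) G_monic[OF that(2) is_kernel_monic[OF K]]] .
  have "(L, l) \<in> Obj \<E>"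
  proof (rule ext_objI[OF L _ l])
    show "l \<in> extensional {1..n}" by (simp add: l_def)
  next
    fix i j assume i: "i \<in> {1..n}" and j: "j \<in> {1..n}" and ij: "i + j \<le> n"
    then have ij': "i + j \<in> {1..n}" by simp
    note GGk = G_arr[OF i G_arr[OF j k]]
    note \<Psi>X = \<Psi>_arr[OF i j ij ext_objD(1)[OF \<gamma>'(1)]] and \<Psi>L = \<Psi>_arr[OF i j ij L]
    have "amap (G i) (amap (G j) k) \<cdot> (amap (G i) (l j) \<cdot> l i) = \<Psi> i j X \<cdot> (\<alpha> (i + j) \<cdot> k)"
      using *[OF i j] ext_objD(3)[OF \<gamma>'(1) i j ij] comp_assoc[OF \<Psi>X ext_objD(2)[OF \<gamma>'(1) ij'] k] by simp
    also have "\<dots> = (\<Psi> i j X \<cdot> amap (G (i + j)) k) \<cdot> l (i + j)"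
      using kl[OF ij'] comp_assoc[OF \<Psi>X G_arr[OF ij' k] l[OF ij']] by simp
    also have "\<dots> = amap (G i) (amap (G j) k) \<cdot> (\<Psi> i j L \<cdot> l (i + j))"
      using \<Psi>_natural[OF i j ij k] comp_assoc[OF GGk \<Psi>L l[OF ij']] by simp
    finally show "amap (G i) (l j) \<cdot> l i = \<Psi> i j L \<cdot> l (i + j)"
      using monic_cancel[OF mono[OF i j] comp_arr[OF G_arr[OF i l[OF j]] l[OF i]]
          comp_arr[OF \<Psi>L l[OF ij']]] by simp
  next
    fix i j assume i: "i \<in> {1..n}" and j: "j \<in> {1..n}" and ij: "\<not> i + j \<le> n"
    show "amap (G i) (l j) \<cdot> l i = Zero C L (omap (G i) (omap (G j) L))"
      using monic_zero_cancel[OF mono[OF i j] comp_arr[OF G_arr[OF i l[OF j]] l[OF i]]]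
        *[OF i j] ext_objD(4)[OF \<gamma>'(1) i j ij] zero_comp[OF k G_obj[OF i G_obj[OF j arr_obj(2)[OF k]]]]
      by simp
  qed
  then have "k \<Zcolon>\<^bsub>\<E>\<^esub> (L, l) \<rightarrow> (X, \<alpha>)" using \<gamma>'(1) k kl by (simp add: ext_arr_iff)
  then show thesis using that K by blast
qed

text \<open>The kernel inclusion and the zero map out of the base kernel are both morphisms of the
  extension equalized by \<open>\<gamma>\<close>. Hence the inclusion is zero, which is monicity in
  the base.\<close>

lemma ext_monic_imp_monic:
  assumes m: "monic \<E> (X, \<alpha>) (Y, \<beta>) \<gamma>"
  shows "monic C X Y \<gamma>"
proof -
  note \<gamma> = monic_arr[OF m]
  obtain L l k where K: "is_kernel C X Y \<gamma> L k" and k: "k \<Zcolon>\<^bsub>\<E>\<^esub> (L, l) \<rightarrow> (X, \<alpha>)"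
    using ext_kernel[OF \<gamma>] .
  note k' = ext_arrD[OF k]
  note X = arr_obj(2)[OF k'(3)] and L = arr_obj(1)[OF k'(3)]
  have z: "Zero C L X \<Zcolon>\<^bsub>\<E>\<^esub> (L, l) \<rightarrow> (X, \<alpha>)"
    using k'(1,2) zero_arr[OF L X] comp_zero[OF ext_objD(2)[OF k'(2)] L]
      zero_comp[OF ext_objD(2)[OF k'(1)] G_obj[OF _ X]] G_zero[OF _ L X]
    by (simp add: ext_arr_iff)
  have "\<gamma> \<cdot> k = \<gamma> \<cdot> Zero C L X"
    using is_kernel_zero[OF K] comp_zero[OF ext_arrD(3)[OF \<gamma>] L] by simp
  then have k0: "k = Zero C L X" using monic_cancel[OF m k z] by simp
  show ?thesis
  proof (rule monicI[OF ext_arrD(3)[OF \<gamma>]])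
    fix Z t assume t: "t \<Zcolon> Z \<rightarrow> X" and "\<gamma> \<cdot> t = Zero C Z Y"
    then obtain u where "u \<Zcolon> Z \<rightarrow> L" "k \<cdot> u = t" using is_kernel_lift[OF K] by blast
    then show "t = Zero C Z X" using zero_comp[OF _ X] k0 by auto
  qed
qed

lemma ext_monicI:
  assumes "\<gamma> \<Zcolon>\<^bsub>\<E>\<^esub> (X, \<alpha>) \<rightarrow> (Y, \<beta>)" "monic C X Y \<gamma>"
  shows "monic \<E> (X, \<alpha>) (Y, \<beta>) \<gamma>"
  unfolding monic_def
proof (intro conjI ballI impI)
  show "(X, \<alpha>) \<in> Obj \<E>" "(Y, \<beta>) \<in> Obj \<E>" "\<gamma> \<in> Hom \<E> (X, \<alpha>) (Y, \<beta>)"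
    using assms(1) by (auto simp: arr_def)
  fix Z u v assume Z: "Z \<in> Obj \<E>" and u: "u \<in> Hom \<E> Z (X, \<alpha>)" and v: "v \<in> Hom \<E> Z (X, \<alpha>)"
    and eq: "\<gamma> \<cdot>\<^bsub>\<E>\<^esub> u = \<gamma> \<cdot>\<^bsub>\<E>\<^esub> v"
  obtain Z' \<zeta> where "Z = (Z', \<zeta>)" by force
  then have "u \<Zcolon> Z' \<rightarrow> X" "v \<Zcolon> Z' \<rightarrow> X"
    using ext_arrD(3)[of u Z' \<zeta> X \<alpha>] ext_arrD(3)[of v Z' \<zeta> X \<alpha>] Z u v assms(1)
    by (auto simp: arr_def)
  then show "u = v" using monic_cancel[OF assms(2)] eq by simp
qed

section \<open>Splitting off a complement in the extension\<close>

text \<open>The complement of the idempotent \<open>s \<cdot> r\<close> is the kernel of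
  \<open>r\<close>. Everything must be checked to be compatible with the structure maps, since
  \<open>direct_summand\<close> is taken in the extension.\<close>

lemma ext_split_monic_complement:
  assumes s: "s \<Zcolon>\<^bsub>\<E>\<^esub> (X, \<alpha>) \<rightarrow> (Y, \<beta>)" and r: "r \<Zcolon>\<^bsub>\<E>\<^esub> (Y, \<beta>) \<rightarrow> (X, \<alpha>)" and rs: "r \<cdot> s = Ident C X"
  obtains L l k p where "is_biproduct2 \<E> (X, \<alpha>) (L, l) (Y, \<beta>) s k r p"
proof -
  note s' = ext_arrD[OF s] and r' = ext_arrD[OF r]
  note X = arr_obj(1)[OF s'(3)] and Y = arr_obj(2)[OF s'(3)]
  note sr = comp_arr[OF s'(3) r'(3)]
  note id = ident_arr[OF Y]
  \<comment> \<open>\<open>w\<close> is minus \<open>s \<cdot> r\<close>, so that \<open>q\<close>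
    below is the complementary idempotent, the identity minus \<open>s \<cdot> r\<close>.\<close>
  obtain w where w: "w \<Zcolon> Y \<rightarrow> Y" "Add C (s \<cdot> r) w = Zero C Y Y" using ex_neg[OF sr] .
  define q where "q = Add C w (Ident C Y)"
  have q: "q \<Zcolon> Y \<rightarrow> Y" unfolding q_def by (rule add_arr[OF w(1) id])
  have srq: "Add C (s \<cdot> r) q = Ident C Y"
    unfolding q_def using add_assoc[OF sr w(1) id] w(2) zero_add[OF id] by simp
  have rsr: "r \<cdot> (s \<cdot> r) = r" using comp_assoc[OF r'(3) s'(3) r'(3)] rs ident_comp[OF r'(3)] by simp
  have srs: "(s \<cdot> r) \<cdot> s = s" using comp_assoc[OF s'(3) r'(3) s'(3)] rs comp_ident[OF s'(3)] by simp
  have rq: "r \<cdot> q = Zero C Y X"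
  proof (rule add_cancel[OF r'(3) comp_arr[OF r'(3) q] zero_arr[OF Y X]])
    have "Add C (r \<cdot> (s \<cdot> r)) (r \<cdot> q) = r \<cdot> Ident C Y" using comp_add_right[OF r'(3) sr q] srq by simp
    then show "Add C r (r \<cdot> q) = Add C r (Zero C Y X)"
      using rsr comp_ident[OF r'(3)] add_zero[OF r'(3)] by simp
  qed
  have qs: "q \<cdot> s = Zero C X Y"
  proof (rule add_cancel[OF s'(3) comp_arr[OF q s'(3)] zero_arr[OF X Y]])
    have "Add C ((s \<cdot> r) \<cdot> s) (q \<cdot> s) = Ident C Y \<cdot> s" using comp_add_left[OF sr q s'(3)] srq by simp
    then show "Add C s (q \<cdot> s) = Add C s (Zero C X Y)"
      using srs ident_comp[OF s'(3)] add_zero[OF s'(3)] by simp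
  qed
  \<comment> \<open>Both the identity and \<open>s \<cdot> r\<close> commute with
    \<open>\<beta> i\<close>; cancelling the latter from the former gives the claim for
    \<open>q\<close>.\<close>
  have q_ext: "q \<Zcolon>\<^bsub>\<E>\<^esub> (Y, \<beta>) \<rightarrow> (Y, \<beta>)"
    unfolding ext_arr_iff
  proof (intro conjI ballI)
    show "(Y, \<beta>) \<in> Obj \<E>" "(Y, \<beta>) \<in> Obj \<E>" "q \<Zcolon> Y \<rightarrow> Y" using r'(1) q by auto
    fix i assume i: "i \<in> {1..n}"
    note \<beta> = ext_objD(2)[OF r'(1) i]
    note Gsr = G_arr[OF i sr] and Gq = G_arr[OF i q]
    show "\<beta> i \<cdot> q = amap (G i) q \<cdot> \<beta> i"
    proof (rule add_cancel[OF comp_arr[OF \<beta> sr] comp_arr[OF \<beta> q] comp_arr[OF Gq \<beta>]])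
      have "Add C (\<beta> i \<cdot> (s \<cdot> r)) (\<beta> i \<cdot> q) = \<beta> i"
        using comp_add_right[OF \<beta> sr q] srq comp_ident[OF \<beta>] by simp
      also have "\<dots> = Add C (amap (G i) (s \<cdot> r)) (amap (G i) q) \<cdot> \<beta> i"
        using additive_functor_add[OF G_additive[OF i] sr q] srq G_ident[OF i Y] ident_comp[OF \<beta>] by simp
      also have "\<dots> = Add C (\<beta> i \<cdot> (s \<cdot> r)) (amap (G i) q \<cdot> \<beta> i)"
        using comp_add_left[OF Gsr Gq \<beta>] ext_arrD(4)[OF ext_comp_arr[OF s r] i] by simp
      finally show "Add C (\<beta> i \<cdot> (s \<cdot> r)) (\<beta> i \<cdot> q) = Add C (\<beta> i \<cdot> (s \<cdot> r)) (amap (G i) q \<cdot> \<beta> i)" .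
    qed
  qed
  obtain L l k where K: "is_kernel C Y X r L k" and k: "k \<Zcolon>\<^bsub>\<E>\<^esub> (L, l) \<rightarrow> (Y, \<beta>)"
    using ext_kernel[OF r] .
  note k' = ext_arrD[OF k]
  note L = arr_obj(1)[OF k'(3)]
  note mk = is_kernel_monic[OF K]
  obtain p where p: "p \<Zcolon> Y \<rightarrow> L" "k \<cdot> p = q" using is_kernel_lift[OF K q rq] .
  have p_ext: "p \<Zcolon>\<^bsub>\<E>\<^esub> (Y, \<beta>) \<rightarrow> (L, l)" using ext_arr_factor[OF k mk _ p(1)] p(2) q_ext by simp
  \<comment> \<open>Split the identity as \<open>s \<cdot> r\<close> plus \<open>q\<close>: the
    first part kills \<open>k\<close>, and \<open>q\<close> is \<open>k \<cdot> p\<close>.\<close>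
  have "k \<cdot> (p \<cdot> k) = k"
  proof -
    have "k = Ident C Y \<cdot> k" using ident_comp[OF k'(3)] by simp
    also have "\<dots> = Add C ((s \<cdot> r) \<cdot> k) (q \<cdot> k)" using srq comp_add_left[OF sr q k'(3)] by simp
    also have "(s \<cdot> r) \<cdot> k = Zero C L Y"
      using comp_assoc[OF s'(3) r'(3) k'(3)] is_kernel_zero[OF K] comp_zero[OF s'(3) L] by simp
    finally show ?thesis
      using zero_add[OF comp_arr[OF q k'(3)]] comp_assoc[OF k'(3) p(1) k'(3)] p(2) by simp
  qed
  then have pk: "p \<cdot> k = Ident C L"
    using monic_cancel[OF mk comp_arr[OF p(1) k'(3)] ident_arr[OF L]] comp_ident[OF k'(3)] by simp
  have ps: "p \<cdot> s = Zero C X L"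
    using monic_zero_cancel[OF mk comp_arr[OF p(1) s'(3)]] comp_assoc[OF k'(3) p(1) s'(3)] p(2) qs by simp
  have "is_biproduct2 \<E> (X, \<alpha>) (L, l) (Y, \<beta>) s k r p"
    using s r k p_ext rs pk ps is_kernel_zero[OF K] srq p(2) by (simp add: is_biproduct2_def arr_def)
  then show thesis using that by blast
qed

subsection \<open>The functor \<open>K\<close>\<close>

text \<open>Packs the family \<open>g\<close> into one map \<open>m\<close>, so that being killed by
  every \<open>g i\<close> becomes being killed by \<open>m\<close>. The biproduct is arbitrary, to
  cover both the chosen one in \<open>K_obj\<close> and an unspecified one.\<close>

lemma ext_structure_map:
  assumes X: "(X, g) \<in> Obj \<E>" and b: "is_biproduct C {1..n} (\<lambda>i. omap (G i) X) T \<iota> \<pi>"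
  obtains m where "m \<Zcolon> X \<rightarrow> T" "\<And>i. i \<in> {1..n} \<Longrightarrow> \<pi> i \<cdot> m = g i"
    "\<And>Z t. t \<Zcolon> Z \<rightarrow> X \<Longrightarrow> m \<cdot> t = Zero C Z T \<longleftrightarrow> (\<forall>i \<in> {1..n}. g i \<cdot> t = Zero C Z (omap (G i) X))"
proof -
  note X' = ext_objD[OF X]
  note b' = is_biproductD[OF b]
  obtain m where m: "m \<Zcolon> X \<rightarrow> T" "\<And>i. i \<in> {1..n} \<Longrightarrow> \<pi> i \<cdot> m = g i"
    using biproduct_lift[OF b X'(1,2)] by blast
  moreover have "m \<cdot> t = Zero C Z T \<longleftrightarrow> (\<forall>i \<in> {1..n}. g i \<cdot> t = Zero C Z (omap (G i) X))"
    if t: "t \<Zcolon> Z \<rightarrow> X" for Z t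
  proof -
    note Z = arr_obj(1)[OF t]
    have *: "\<pi> i \<cdot> (m \<cdot> t) = g i \<cdot> t" "\<pi> i \<cdot> Zero C Z T = Zero C Z (omap (G i) X)" if "i \<in> {1..n}" for i
      using comp_assoc[OF b'(5)[OF that] m(1) t] m(2)[OF that] comp_zero[OF b'(5)[OF that] Z] by auto
    show ?thesis
      using biproduct_proj_jointly_monic[OF b comp_arr[OF m(1) t] zero_arr[OF Z b'(2)]] * by metis
  qed
  ultimately show thesis using that by blast
qed

text \<open>All that is used of \<open>K\<close> afterwards: the chosen direct sum, the
  \<open>THE\<close> and the chosen kernel disappear here. Uniqueness of the factorization is
  contained in \<open>monic\<close>.\<close>

lemma K_obj_universal:
  assumes X: "(X, g) \<in> Obj \<E>"
  obtains k where "monic C (K_obj C n G (X, g)) X k"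
    "\<And>i. i \<in> {1..n} \<Longrightarrow> g i \<cdot> k = Zero C (K_obj C n G (X, g)) (omap (G i) X)"
    "\<And>Z t. \<lbrakk>t \<Zcolon> Z \<rightarrow> X; \<And>i. i \<in> {1..n} \<Longrightarrow> g i \<cdot> t = Zero C Z (omap (G i) X)\<rbrakk>
      \<Longrightarrow> \<exists>u. u \<Zcolon> Z \<rightarrow> K_obj C n G (X, g) \<and> k \<cdot> u = t"
proof -
  let ?A = "\<lambda>i. omap (G i) X"
  let ?T = "dsum_obj C {1..n} ?A"
  let ?K = "K_obj C n G (X, g)"
  have b: "is_biproduct C {1..n} ?A ?T (dsum_inj C {1..n} ?A) (dsum_proj C {1..n} ?A)"
    using G_obj ext_objD(1)[OF X] by (intro dsum_is_biproduct) auto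
  obtain m where m: "m \<Zcolon> X \<rightarrow> ?T" "\<And>i. i \<in> {1..n} \<Longrightarrow> dsum_proj C {1..n} ?A i \<cdot> m = g i"
    and mz: "\<And>Z t. t \<Zcolon> Z \<rightarrow> X \<Longrightarrow>
      m \<cdot> t = Zero C Z ?T \<longleftrightarrow> (\<forall>i \<in> {1..n}. g i \<cdot> t = Zero C Z (?A i))"
    using ext_structure_map[OF X b] by blast
  \<comment> \<open>\<open>THE\<close> is well defined because the projections of the direct sum are
    jointly monic.\<close>
  have "(THE m. m \<in> Hom C X ?T \<and> (\<forall>i \<in> {1..n}. dsum_proj C {1..n} ?A i \<cdot> m = g i)) = m"
  proof (rule the_equality)
    show "m \<in> Hom C X ?T \<and> (\<forall>i \<in> {1..n}. dsum_proj C {1..n} ?A i \<cdot> m = g i)"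
      using m by (auto simp: arr_def)
    fix m' assume "m' \<in> Hom C X ?T \<and> (\<forall>i \<in> {1..n}. dsum_proj C {1..n} ?A i \<cdot> m' = g i)"
    then show "m' = m"
      using biproduct_proj_jointly_monic[OF b _ m(1), of m'] m by (auto simp: arr_def)
  qed
  then have K: "?K = kernel_obj C X ?T m" by (simp add: K_obj_def Let_def)
  obtain k where "is_kernel C X ?T m (kernel_obj C X ?T m) k" using kernel_obj_is_kernel[OF m(1)] .
  then have k: "is_kernel C X ?T m ?K k" unfolding K .
  show thesis
  proof (rule that)
    show "monic C ?K X k" using is_kernel_monic[OF k] .
    show "g i \<cdot> k = Zero C ?K (?A i)" if "i \<in> {1..n}" for i
      using mz[OF is_kernel_arr(1)[OF k]] is_kernel_zero[OF k] that by blast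
    show "\<exists>u. u \<Zcolon> Z \<rightarrow> ?K \<and> k \<cdot> u = t"
      if "t \<Zcolon> Z \<rightarrow> X" "\<And>i. i \<in> {1..n} \<Longrightarrow> g i \<cdot> t = Zero C Z (?A i)" for Z t
      using is_kernel_lift[OF k that(1)] mz[OF that(1)] that(2) by blast
  qed
qed

text \<open>
  The structure maps are jointly monic, so \<open>G\<^sub>i(g\<^sub>j) \<circ> g\<^sub>i = 0\<close> for all \<open>j\<close> forces \<open>g\<^sub>i = 0\<close>;
  this applies in turn to \<open>i = n, n - 1, \<dots>, 1\<close>.
\<close>

lemma ext_ident_zero:
  assumes X: "(X, g) \<in> Obj \<E>"
    and z: "\<And>Z t. \<lbrakk>t \<Zcolon> Z \<rightarrow> X; \<And>i. i \<in> {1..n} \<Longrightarrow> g i \<cdot> t = Zero C Z (omap (G i) X)\<rbrakk> \<Longrightarrow> t = Zero C Z X"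
  shows "Ident C X = Zero C X X"
proof -
  note X' = ext_objD[OF X]
  let ?A = "\<lambda>i. omap (G i) X"
  obtain T \<iota> \<pi> where b: "is_biproduct C {1..n} ?A T \<iota> \<pi>"
    using ex_biproduct[of "{1..n}" ?A] G_obj X'(1) by auto
  note b' = is_biproductD[OF b]
  obtain m where m: "m \<Zcolon> X \<rightarrow> T" "\<And>i. i \<in> {1..n} \<Longrightarrow> \<pi> i \<cdot> m = g i"
    and mz: "\<And>Z t. t \<Zcolon> Z \<rightarrow> X \<Longrightarrow> m \<cdot> t = Zero C Z T \<longleftrightarrow> (\<forall>i \<in> {1..n}. g i \<cdot> t = Zero C Z (?A i))"
    using ext_structure_map[OF X b] by blast
  have mono: "monic C X T m" using mz z by (intro monicI[OF m(1)]) blast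
  have g0: "g i = Zero C X (?A i)" if "i \<in> {1..n}" for i
    using that
  proof (induction "n - i" arbitrary: i rule: less_induct)
    case less
    note i = less.prems
    note Gm = G_arr[OF i m(1)]
    have "amap (G i) m \<cdot> g i = Zero C X (omap (G i) T)"
    proof (rule biproduct_proj_jointly_monic[OF G_biproduct[OF i b] comp_arr[OF Gm X'(2)[OF i]]
          zero_arr[OF X'(1) G_obj[OF i b'(2)]]])
      fix j assume j: "j \<in> {1..n}"
      note G\<pi> = G_arr[OF i b'(5)[OF j]]
      have "amap (G i) (\<pi> j) \<cdot> (amap (G i) m \<cdot> g i) = amap (G i) (g j) \<cdot> g i"
        using comp_assoc[OF G\<pi> Gm X'(2)[OF i]] G_comp[OF i b'(5)[OF j] m(1)] m(2)[OF j] by simp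
      also have "\<dots> = Zero C X (omap (G i) (?A j))"
      proof (cases "i + j \<le> n")
        case True
        then have "g (i + j) = Zero C X (?A (i + j))" using i j by (intro less.hyps) auto
        then show ?thesis
          using X'(3)[OF i j True] comp_zero[OF \<Psi>_arr[OF i j True X'(1)] X'(1)] by simp
      next
        case False
        then show ?thesis using X'(4)[OF i j] by simp
      qed
      also have "\<dots> = amap (G i) (\<pi> j) \<cdot> Zero C X (omap (G i) T)"
        using comp_zero[OF G\<pi> X'(1)] by simp
      finally show "amap (G i) (\<pi> j) \<cdot> (amap (G i) m \<cdot> g i) = amap (G i) (\<pi> j) \<cdot> Zero C X (omap (G i) T)" .
    qed
    then show ?case using monic_zero_cancel[OF G_monic[OF i mono] X'(2)[OF i]] by simp
  qed
  \<comment> \<open>Once all \<open>g i\<close> are zero, the identity is itself killed by them, and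
    \<open>z\<close> applies to it.\<close>
  show ?thesis
    using z[OF ident_arr[OF X'(1)]] g0 comp_ident[OF X'(2)] by simp
qed

section \<open>Zero structure maps and injectivity of \<open>K(X, f)\<close>\<close>

lemma zero_structure_obj:
  assumes P: "P \<in> Obj C"
  shows "(P, \<lambda>i\<in>{1..n}. Zero C P (omap (G i) P)) \<in> Obj \<E>"
proof (rule ext_objI[OF P])
  note GP = G_obj[OF _ P]
  show "(\<lambda>i\<in>{1..n}. Zero C P (omap (G i) P)) i \<Zcolon> P \<rightarrow> omap (G i) P" if "i \<in> {1..n}" for i
    using zero_arr[OF P GP] that by simp
  fix i j assume i: "i \<in> {1..n}" and j: "j \<in> {1..n}"
  have *: "amap (G i) ((\<lambda>i\<in>{1..n}. Zero C P (omap (G i) P)) j) \<cdot> (\<lambda>i\<in>{1..n}. Zero C P (omap (G i) P)) i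
      = Zero C P (omap (G i) (omap (G j) P))"
    using i j comp_zero[OF G_arr[OF i zero_arr[OF P GP[OF j]]] P] by simp
  show "amap (G i) ((\<lambda>i\<in>{1..n}. Zero C P (omap (G i) P)) j) \<cdot> (\<lambda>i\<in>{1..n}. Zero C P (omap (G i) P)) i
      = \<Psi> i j P \<cdot> (\<lambda>i\<in>{1..n}. Zero C P (omap (G i) P)) (i + j)" if "i + j \<le> n"
    using * i j that comp_zero[OF \<Psi>_arr[OF i j that P] P] by simp
  show "amap (G i) ((\<lambda>i\<in>{1..n}. Zero C P (omap (G i) P)) j) \<cdot> (\<lambda>i\<in>{1..n}. Zero C P (omap (G i) P)) i
      = Zero C P (omap (G i) (omap (G j) P))" if "\<not> i + j \<le> n"
    by (rule *)
qed simp

text \<open>Together with \<open>K_obj_universal\<close> this is the adjunction: such maps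
  \<open>t\<close> are exactly those factoring through \<open>K(X, g)\<close>.\<close>

lemma zero_structure_arr_iff:
  assumes P: "P \<in> Obj C" and X: "(X, g) \<in> Obj \<E>"
  shows "t \<Zcolon>\<^bsub>\<E>\<^esub> (P, \<lambda>i\<in>{1..n}. Zero C P (omap (G i) P)) \<rightarrow> (X, g) \<longleftrightarrow>
    t \<Zcolon> P \<rightarrow> X \<and> (\<forall>i \<in> {1..n}. g i \<cdot> t = Zero C P (omap (G i) X))"
  using zero_structure_obj[OF P] X comp_zero[OF G_arr P] by (auto simp: ext_arr_iff)

text \<open>A base monomorphism \<open>m\<close> stays monic between zero structures. So
  \<open>k \<cdot> u\<close> extends along \<open>m\<close> inside \<open>(X, f)\<close>, and the
  extension, starting at a zero structure, factors through \<open>K(X, f)\<close> again.\<close>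

lemma K_obj_injective:
  assumes inj: "injective_object \<E> (X, f)"
  shows "injective_object C (K_obj C n G (X, f))"
  unfolding injective_object_def
proof (intro conjI allI impI)
  note X = injective_object_obj[OF inj]
  let ?K = "K_obj C n G (X, f)"
  obtain k where mk: "monic C ?K X k"
    and kz: "\<And>i. i \<in> {1..n} \<Longrightarrow> f i \<cdot> k = Zero C ?K (omap (G i) X)"
    and ku: "\<And>Z t. \<lbrakk>t \<Zcolon> Z \<rightarrow> X; \<And>i. i \<in> {1..n} \<Longrightarrow> f i \<cdot> t = Zero C Z (omap (G i) X)\<rbrakk>
      \<Longrightarrow> \<exists>u. u \<Zcolon> Z \<rightarrow> ?K \<and> k \<cdot> u = t"
    using K_obj_universal[OF X] by blast
  note k = monic_arr[OF mk]
  show "?K \<in> Obj C" using arr_obj(1)[OF k] .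
  fix P Q m u assume "monic C P Q m \<and> u \<in> Hom C P ?K"
  then have m: "monic C P Q m" and u: "u \<Zcolon> P \<rightarrow> ?K"
    using arr_obj(1)[OF k] by (auto simp: monic_def arr_def)
  note P = arr_obj(1)[OF u] and Q = arr_obj(2)[OF monic_arr[OF m]]
  let ?P = "(P, \<lambda>i\<in>{1..n}. Zero C P (omap (G i) P))"
  let ?Q = "(Q, \<lambda>i\<in>{1..n}. Zero C Q (omap (G i) Q))"
  have "m \<Zcolon>\<^bsub>\<E>\<^esub> ?P \<rightarrow> ?Q"
    using zero_structure_arr_iff[OF P zero_structure_obj[OF Q]] monic_arr[OF m]
      zero_comp[OF monic_arr[OF m] G_obj[OF _ Q]] by simp
  then have m': "monic \<E> ?P ?Q m" using m by (rule ext_monicI)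
  have "f i \<cdot> (k \<cdot> u) = Zero C P (omap (G i) X)" if i: "i \<in> {1..n}" for i
    using comp_assoc[OF ext_objD(2)[OF X i] k u] kz[OF i] zero_comp[OF u G_obj[OF i ext_objD(1)[OF X]]]
    by simp
  then have "k \<cdot> u \<Zcolon>\<^bsub>\<E>\<^esub> ?P \<rightarrow> (X, f)"
    using zero_structure_arr_iff[OF P X] comp_arr[OF k u] by simp
  then obtain v where v: "v \<Zcolon>\<^bsub>\<E>\<^esub> ?Q \<rightarrow> (X, f)" and vm: "v \<cdot>\<^bsub>\<E>\<^esub> m = k \<cdot> u"
    using injective_object_extend[OF inj m'] by blast
  then have "v \<Zcolon> Q \<rightarrow> X" "\<And>i. i \<in> {1..n} \<Longrightarrow> f i \<cdot> v = Zero C Q (omap (G i) X)"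
    using zero_structure_arr_iff[OF Q X] by auto
  then obtain v' where v': "v' \<Zcolon> Q \<rightarrow> ?K" "k \<cdot> v' = v" using ku by blast
  have "k \<cdot> (v' \<cdot> m) = k \<cdot> u" using comp_assoc[OF k v'(1) monic_arr[OF m]] v'(2) vm by simp
  then have "v' \<cdot> m = u" using monic_cancel[OF mk comp_arr[OF v'(1) monic_arr[OF m]] u] by simp
  then show "\<exists>v \<in> Hom C Q ?K. v \<cdot> m = u" using v'(1) by (auto simp: arr_def)
qed

subsection \<open>The functor \<open>H\<close>\<close>

text \<open>The only entry of row \<open>j\<close> of \<open>\<lambda>\<close> that can be nonzero,
  found in column \<open>i + j\<close>. The value at \<open>j = 0\<close> acts as a
  \<open>\<Psi>\<close> with second index 0 equal to the identity, which puts index 0 on the same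
  footing as the others.\<close>

definition H_entry :: "'o \<Rightarrow> nat \<Rightarrow> nat \<Rightarrow> 'm" where
  "H_entry Y i j = (if j = 0 then Ident C (omap (G i) Y) else \<Psi> i j Y)"

text \<open>Describes \<open>H(Y)\<close> by whole rows instead of matrix entries and for any
  biproduct, freeing later arguments from \<open>THE\<close>. The name refers to the universal
  property of a right adjoint to the forgetful functor.\<close>

definition is_cofree :: "'o \<Rightarrow> 'o \<Rightarrow> (nat \<Rightarrow> 'm) \<Rightarrow> (nat \<Rightarrow> 'm) \<Rightarrow> (nat \<Rightarrow> 'm) \<Rightarrow> bool" where
  "is_cofree Y S \<iota> \<pi> \<sigma> \<longleftrightarrow> Y \<in> Obj C \<and> is_biproduct C {0..n} (H_summand G Y) S \<iota> \<pi> \<and>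
     \<sigma> \<in> extensional {1..n} \<and> (\<forall>i \<in> {1..n}. \<sigma> i \<Zcolon> S \<rightarrow> omap (G i) S \<and>
       (\<forall>j \<in> {0..n}. amap (G i) (\<pi> j) \<cdot> \<sigma> i =
          (if i + j \<le> n then H_entry Y i j \<cdot> \<pi> (i + j)
           else Zero C S (omap (G i) (H_summand G Y j)))))"

lemma is_cofreeD:
  assumes "is_cofree Y S \<iota> \<pi> \<sigma>"
  shows "Y \<in> Obj C" "is_biproduct C {0..n} (H_summand G Y) S \<iota> \<pi>" "\<sigma> \<in> extensional {1..n}"
    "i \<in> {1..n} \<Longrightarrow> \<sigma> i \<Zcolon> S \<rightarrow> omap (G i) S"
    "\<lbrakk>i \<in> {1..n}; j \<in> {0..n}; i + j \<le> n\<rbrakk> \<Longrightarrow> amap (G i) (\<pi> j) \<cdot> \<sigma> i = H_entry Y i j \<cdot> \<pi> (i + j)"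
    "\<lbrakk>i \<in> {1..n}; j \<in> {0..n}; \<not> i + j \<le> n\<rbrakk>
      \<Longrightarrow> amap (G i) (\<pi> j) \<cdot> \<sigma> i = Zero C S (omap (G i) (H_summand G Y j))"
  using assms by (auto simp: is_cofree_def)

lemma H_summand_obj: "\<lbrakk>Y \<in> Obj C; j \<in> {0..n}\<rbrakk> \<Longrightarrow> H_summand G Y j \<in> Obj C"
  using G_obj[of j Y] by (auto simp: H_summand_def)

lemma H_entry_arr:
  assumes "Y \<in> Obj C" "i \<in> {1..n}" "i + j \<le> n"
  shows "H_entry Y i j \<Zcolon> H_summand G Y (i + j) \<rightarrow> omap (G i) (H_summand G Y j)"
  using assms ident_arr[OF G_obj[OF assms(2,1)]] \<Psi>_arr[of i j Y]
  by (auto simp: H_entry_def H_summand_def)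

text \<open>Coassociativity extended to \<open>k = 0\<close>, where it reduces to identity
  laws.\<close>

lemma H_entry_coassoc:
  assumes Y: "Y \<in> Obj C" and i: "i \<in> {1..n}" and j: "j \<in> {1..n}" and ijk: "i + j + k \<le> n"
  shows "amap (G i) (H_entry Y j k) \<cdot> H_entry Y i (j + k)
    = \<Psi> i j (H_summand G Y k) \<cdot> H_entry Y (i + j) k"
proof (cases "k = 0")
  case True
  have ij: "i + j \<le> n" using ijk by simp
  note \<Psi> = \<Psi>_arr[OF i j ij Y]
  show ?thesis
    using True j comp_ident[OF \<Psi>] ident_comp[OF \<Psi>] G_ident[OF i G_obj[OF j Y]]
    by (simp add: H_entry_def H_summand_def)
next
  case False
  then show ?thesis
    using \<Psi>_coassoc[OF i j _ ijk Y] j ijk by (simp add: H_entry_def H_summand_def)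
qed

text \<open>A map is assembled from its rows by \<open>biproduct_lift\<close> for
  \<open>G i S\<close>, and its matrix entries are then read off to identify it with the
  \<open>THE\<close> in \<open>H_obj\<close>.\<close>

lemma ex_cofree_structure:
  assumes Y: "Y \<in> Obj C" and b: "is_biproduct C {0..n} (H_summand G Y) S \<iota> \<pi>" and i: "i \<in> {1..n}"
  obtains l where "l \<Zcolon> S \<rightarrow> omap (G i) S"
    "\<And>j. j \<in> {0..n} \<Longrightarrow> amap (G i) (\<pi> j) \<cdot> l =
      (if i + j \<le> n then H_entry Y i j \<cdot> \<pi> (i + j) else Zero C S (omap (G i) (H_summand G Y j)))"
    "(THE l. l \<in> Hom C S (omap (G i) S) \<and> (\<forall>j \<in> {0..n}. \<forall>k \<in> {0..n}.
        amap (G i) (\<pi> j) \<cdot> l \<cdot> \<iota> k = H_component C G \<Psi> Y i j k)) = l"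
proof -
  note b' = is_biproductD[OF b]
  let ?w = "\<lambda>j. if i + j \<le> n then H_entry Y i j \<cdot> \<pi> (i + j)
    else Zero C S (omap (G i) (H_summand G Y j))"
  note Gb = G_biproduct[OF i b]
  have "?w j \<Zcolon> S \<rightarrow> omap (G i) (H_summand G Y j)" if j: "j \<in> {0..n}" for j
    using comp_arr[OF H_entry_arr[OF Y i] b'(5)] zero_arr[OF b'(2) G_obj[OF i b'(3)[OF j]]] by simp
  then obtain l where l: "l \<Zcolon> S \<rightarrow> omap (G i) S"
    and lw: "\<And>j. j \<in> {0..n} \<Longrightarrow> amap (G i) (\<pi> j) \<cdot> l = ?w j"
    using biproduct_lift[OF Gb b'(2), of ?w] by blast
  have comp: "amap (G i) (\<pi> j) \<cdot> l \<cdot> \<iota> k = H_component C G \<Psi> Y i j k"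
    if j: "j \<in> {0..n}" and k: "k \<in> {0..n}" for j k
  proof -
    note GA = G_obj[OF i b'(3)[OF j]]
    have *: "amap (G i) (\<pi> j) \<cdot> l \<cdot> \<iota> k = ?w j \<cdot> \<iota> k"
      using comp_assoc[OF G_arr[OF i b'(5)[OF j]] l b'(4)[OF k]] lw[OF j] by simp
    show ?thesis
    proof (cases "i + j \<le> n")
      case True
      then have ij: "i + j \<in> {0..n}" by simp
      note e = H_entry_arr[OF Y i True]
      have "?w j \<cdot> \<iota> k = H_entry Y i j \<cdot> (\<pi> (i + j) \<cdot> \<iota> k)"
        using True comp_assoc[OF e b'(5)[OF ij] b'(4)[OF k]] by simp
      also have "\<dots> = H_component C G \<Psi> Y i j k"
        using b'(6)[OF ij k] comp_ident[OF e] comp_zero[OF e b'(3)[OF k]]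
        by (auto simp: H_component_def H_entry_def)
      finally show ?thesis using * by simp
    next
      case False
      \<comment> \<open>Column \<open>i + j\<close> lies outside the matrix, so
        \<open>H_component\<close> is zero in the whole row.\<close>
      then have "k \<noteq> i + j" using k by auto
      then show ?thesis
        using * False zero_comp[OF b'(4)[OF k] GA] by (simp add: H_component_def)
    qed
  qed
  have "(THE l. l \<in> Hom C S (omap (G i) S) \<and> (\<forall>j \<in> {0..n}. \<forall>k \<in> {0..n}.
        amap (G i) (\<pi> j) \<cdot> l \<cdot> \<iota> k = H_component C G \<Psi> Y i j k)) = l"
  proof (rule the_equality)
    show "l \<in> Hom C S (omap (G i) S) \<and> (\<forall>j \<in> {0..n}. \<forall>k \<in> {0..n}.
        amap (G i) (\<pi> j) \<cdot> l \<cdot> \<iota> k = H_component C G \<Psi> Y i j k)"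
      using l comp by (simp add: arr_def)
    fix l' assume l'_def: "l' \<in> Hom C S (omap (G i) S) \<and> (\<forall>j \<in> {0..n}. \<forall>k \<in> {0..n}.
        amap (G i) (\<pi> j) \<cdot> l' \<cdot> \<iota> k = H_component C G \<Psi> Y i j k)"
    then have l': "l' \<Zcolon> S \<rightarrow> omap (G i) S" using l by (simp add: arr_def)
    \<comment> \<open>A matrix determines its map: injections of \<open>S\<close> test on the right,
      projections of \<open>G i S\<close> on the left.\<close>
    show "l' = l"
    proof (rule biproduct_inj_jointly_epic[OF b l' l])
      fix k assume k: "k \<in> {0..n}"
      show "l' \<cdot> \<iota> k = l \<cdot> \<iota> k"
        using l'_def comp k
        by (intro biproduct_proj_jointly_monic[OF Gb comp_arr[OF l' b'(4)] comp_arr[OF l b'(4)]]) auto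
    qed
  qed
  then show thesis using that l lw by blast
qed

lemma H_obj_is_cofree:
  assumes Y: "Y \<in> Obj C"
  obtains S \<iota> \<pi> \<sigma> where "H_obj C n G \<Psi> Y = (S, \<sigma>)" "is_cofree Y S \<iota> \<pi> \<sigma>"
proof -
  let ?A = "H_summand G Y"
  let ?S = "dsum_obj C {0..n} ?A" and ?\<iota> = "dsum_inj C {0..n} ?A" and ?\<pi> = "dsum_proj C {0..n} ?A"
  let ?\<sigma> = "\<lambda>i\<in>{1..n}. THE l. l \<in> Hom C ?S (omap (G i) ?S) \<and> (\<forall>j \<in> {0..n}. \<forall>k \<in> {0..n}.
     amap (G i) (?\<pi> j) \<cdot> l \<cdot> ?\<iota> k = H_component C G \<Psi> Y i j k)"
  have b: "is_biproduct C {0..n} ?A ?S ?\<iota> ?\<pi>"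
    using H_summand_obj[OF Y] by (intro dsum_is_biproduct) auto
  have "?\<sigma> i \<Zcolon> ?S \<rightarrow> omap (G i) ?S \<and> (\<forall>j \<in> {0..n}. amap (G i) (?\<pi> j) \<cdot> ?\<sigma> i =
      (if i + j \<le> n then H_entry Y i j \<cdot> ?\<pi> (i + j) else Zero C ?S (omap (G i) (?A j))))"
    if i: "i \<in> {1..n}" for i
    by (rule ex_cofree_structure[OF Y b i]) (use i in simp)
  then have "is_cofree Y ?S ?\<iota> ?\<pi> ?\<sigma>" using Y b by (simp add: is_cofree_def)
  moreover have "H_obj C n G \<Psi> Y = (?S, ?\<sigma>)" by (simp add: H_obj_def Let_def)
  ultimately show thesis using that by blast
qed

text \<open>Both required equations are compared under the projections of
  \<open>G i (G j S)\<close>. Each structure map shifts the index, so two of them lead to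
  \<open>i + j + k\<close>; up to \<open>n\<close> the entries agree by coassociativity, beyond it
  everything vanishes.\<close>

lemma cofree_obj:
  assumes H: "is_cofree Y S \<iota> \<pi> \<sigma>"
  shows "(S, \<sigma>) \<in> Obj \<E>"
proof -
  note H' = is_cofreeD[OF H]
  note Y = H'(1) and b' = is_biproductD[OF H'(2)]
  note S = b'(2)
  have proj: "amap (G i) (amap (G j) (\<pi> k)) \<cdot> (amap (G i) (\<sigma> j) \<cdot> \<sigma> i) =
      (if i + j + k \<le> n
       then (\<Psi> i j (H_summand G Y k) \<cdot> H_entry Y (i + j) k) \<cdot> \<pi> (i + j + k)
       else Zero C S (omap (G i) (omap (G j) (H_summand G Y k))))"
    if i: "i \<in> {1..n}" and j: "j \<in> {1..n}" and k: "k \<in> {0..n}" for i j k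
  proof -
    note G\<pi> = G_arr[OF j b'(5)[OF k]] and \<sigma>i = H'(4)[OF i] and \<sigma>j = H'(4)[OF j]
    have *: "amap (G i) (amap (G j) (\<pi> k)) \<cdot> (amap (G i) (\<sigma> j) \<cdot> \<sigma> i)
        = amap (G i) (amap (G j) (\<pi> k) \<cdot> \<sigma> j) \<cdot> \<sigma> i"
      using comp_assoc[OF G_arr[OF i G\<pi>] G_arr[OF i \<sigma>j] \<sigma>i] G_comp[OF i G\<pi> \<sigma>j] by simp
    show ?thesis
    proof (cases "j + k \<le> n")
      case True
      then have jk: "j + k \<in> {0..n}" by simp
      note e = H_entry_arr[OF Y j True]
      have **: "amap (G i) (amap (G j) (\<pi> k) \<cdot> \<sigma> j) \<cdot> \<sigma> i
          = amap (G i) (H_entry Y j k) \<cdot> (amap (G i) (\<pi> (j + k)) \<cdot> \<sigma> i)"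
        using H'(5)[OF j k True] G_comp[OF i e b'(5)[OF jk]]
          comp_assoc[OF G_arr[OF i e] G_arr[OF i b'(5)[OF jk]] \<sigma>i] by simp
      show ?thesis
      proof (cases "i + j + k \<le> n")
        case ijk: True
        then have ijk': "i + (j + k) \<le> n" "i + (j + k) \<in> {0..n}" by auto
        have "amap (G i) (H_entry Y j k) \<cdot> (amap (G i) (\<pi> (j + k)) \<cdot> \<sigma> i)
            = (amap (G i) (H_entry Y j k) \<cdot> H_entry Y i (j + k)) \<cdot> \<pi> (i + (j + k))"
          using H'(5)[OF i jk ijk'(1)]
            comp_assoc[OF G_arr[OF i e] H_entry_arr[OF Y i ijk'(1)] b'(5)[OF ijk'(2)]] by simp
        then show ?thesis
          using * ** ijk H_entry_coassoc[OF Y i j ijk] by (simp add: add.assoc)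
      next
        case False
        then have "\<not> i + (j + k) \<le> n" by simp
        then show ?thesis
          using * ** False H'(6)[OF i jk] comp_zero[OF G_arr[OF i e] S] by simp
      qed
    next
      case False
      \<comment> \<open>Here the inner shift already leaves the range, and then
        \<open>i + j + k\<close> does so as well.\<close>
      have "amap (G i) (Zero C S (omap (G j) (H_summand G Y k))) \<cdot> \<sigma> i
          = Zero C S (omap (G i) (omap (G j) (H_summand G Y k)))"
        using G_zero[OF i S G_obj[OF j b'(3)[OF k]]] zero_comp[OF \<sigma>i G_obj[OF i G_obj[OF j b'(3)[OF k]]]]
        by simp
      then show ?thesis using * False H'(6)[OF j k False] by simp
    qed
  qed
  show ?thesis
  proof (rule ext_objI[OF S H'(3,4)])
    fix i j assume i: "i \<in> {1..n}" and j: "j \<in> {1..n}"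
    note \<sigma>\<sigma> = comp_arr[OF G_arr[OF i H'(4)[OF j]] H'(4)[OF i]]
    note GGb = G_biproduct[OF i G_biproduct[OF j H'(2)]]
    show "amap (G i) (\<sigma> j) \<cdot> \<sigma> i = \<Psi> i j S \<cdot> \<sigma> (i + j)" if ij: "i + j \<le> n"
    proof -
      have ij': "i + j \<in> {1..n}" using ij i by simp
      note \<Psi>S = \<Psi>_arr[OF i j ij S] and \<sigma>ij = H'(4)[OF ij']
      show ?thesis
      proof (rule biproduct_proj_jointly_monic[OF GGb \<sigma>\<sigma> comp_arr[OF \<Psi>S \<sigma>ij]])
        fix k assume k: "k \<in> {0..n}"
        note \<pi>k = b'(5)[OF k] and \<Psi>A = \<Psi>_arr[OF i j ij b'(3)[OF k]]
        \<comment> \<open>Naturality moves the projection across \<open>\<Psi>\<close>, reducing the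
          right-hand side to a single row of \<open>\<sigma>\<close>.\<close>
        have *: "amap (G i) (amap (G j) (\<pi> k)) \<cdot> (\<Psi> i j S \<cdot> \<sigma> (i + j))
            = \<Psi> i j (H_summand G Y k) \<cdot> (amap (G (i + j)) (\<pi> k) \<cdot> \<sigma> (i + j))"
          using comp_assoc[OF G_arr[OF i G_arr[OF j \<pi>k]] \<Psi>S \<sigma>ij] \<Psi>_natural[OF i j ij \<pi>k]
            comp_assoc[OF \<Psi>A G_arr[OF ij' \<pi>k] \<sigma>ij] by simp
        show "amap (G i) (amap (G j) (\<pi> k)) \<cdot> (amap (G i) (\<sigma> j) \<cdot> \<sigma> i)
            = amap (G i) (amap (G j) (\<pi> k)) \<cdot> (\<Psi> i j S \<cdot> \<sigma> (i + j))"
        proof (cases "i + j + k \<le> n")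
          case True
          then have "i + j + k \<in> {0..n}" by simp
          then show ?thesis
            using * True proj[OF i j k] H'(5)[OF ij' k True]
              comp_assoc[OF \<Psi>A H_entry_arr[OF Y ij' True] b'(5)] by simp
        next
          case False
          then show ?thesis
            using * proj[OF i j k] H'(6)[OF ij' k False] comp_zero[OF \<Psi>A S] by simp
        qed
      qed
    qed
    \<comment> \<open>With \<open>i + j\<close> beyond \<open>n\<close>, no index \<open>k\<close>
      keeps \<open>i + j + k\<close> in range, so every component is zero.\<close>
    show "amap (G i) (\<sigma> j) \<cdot> \<sigma> i = Zero C S (omap (G i) (omap (G j) S))" if ij: "\<not> i + j \<le> n"
    proof (rule biproduct_proj_jointly_monic[OF GGb \<sigma>\<sigma> zero_arr[OF S G_obj[OF i G_obj[OF j S]]]])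
      fix k assume k: "k \<in> {0..n}"
      show "amap (G i) (amap (G j) (\<pi> k)) \<cdot> (amap (G i) (\<sigma> j) \<cdot> \<sigma> i)
          = amap (G i) (amap (G j) (\<pi> k)) \<cdot> Zero C S (omap (G i) (omap (G j) S))"
        using proj[OF i j k] ij comp_zero[OF G_arr[OF i G_arr[OF j b'(5)[OF k]]] S] by simp
    qed
  qed
qed

section \<open>The universal property of \<open>H(Y)\<close>\<close>

text \<open>Row 0 of \<open>\<sigma> i\<close> has the identity as its entry, so
  \<open>amap (G i) (\<pi> 0) \<cdot> \<sigma> i\<close> is \<open>\<pi> i\<close>; compatibility of
  \<open>h\<close> then forces its component at \<open>i\<close>.\<close>

lemma cofree_proj:
  assumes H: "is_cofree Y S \<iota> \<pi> \<sigma>" and h: "h \<Zcolon>\<^bsub>\<E>\<^esub> (X, g) \<rightarrow> (S, \<sigma>)" and i: "i \<in> {1..n}"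
  shows "\<pi> i \<cdot> h = amap (G i) (\<pi> 0 \<cdot> h) \<cdot> g i"
proof -
  note H' = is_cofreeD[OF H] and h' = ext_arrD[OF h]
  note b' = is_biproductD[OF H'(2)]
  have i0: "0 \<in> {0..n}" "i \<in> {0..n}" "i + 0 \<le> n" using i by auto
  note \<pi>0 = b'(5)[OF i0(1)] and \<pi>i = b'(5)[OF i0(2)] and g = ext_objD(2)[OF h'(1) i]
  have "\<pi> i \<Zcolon> S \<rightarrow> omap (G i) Y" using \<pi>i i by (simp add: H_summand_def)
  then have "amap (G i) (\<pi> 0) \<cdot> \<sigma> i = \<pi> i"
    using H'(5)[OF i i0(1,3)] ident_comp by (simp add: H_entry_def)
  then show ?thesis
    using comp_assoc[OF G_arr[OF i \<pi>0] H'(4)[OF i] h'(3)] h'(4)[OF i]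
      comp_assoc[OF G_arr[OF i \<pi>0] G_arr[OF i h'(3)] g] G_comp[OF i \<pi>0 h'(3)] by simp
qed

lemma cofree_arr_eqI:
  assumes H: "is_cofree Y S \<iota> \<pi> \<sigma>" and h: "h \<Zcolon>\<^bsub>\<E>\<^esub> (X, g) \<rightarrow> (S, \<sigma>)" and h': "h' \<Zcolon>\<^bsub>\<E>\<^esub> (X, g) \<rightarrow> (S, \<sigma>)"
    and eq: "\<pi> 0 \<cdot> h = \<pi> 0 \<cdot> h'"
  shows "h = h'"
proof (rule biproduct_proj_jointly_monic[OF is_cofreeD(2)[OF H] ext_arrD(3)[OF h] ext_arrD(3)[OF h']])
  fix j assume "j \<in> {0..n}"
  then show "\<pi> j \<cdot> h = \<pi> j \<cdot> h'"
    using eq cofree_proj[OF H h, of j] cofree_proj[OF H h', of j] by (cases "j = 0") auto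
qed

text \<open>The existence half of the adjunction, with \<open>\<pi> 0\<close> as counit;
  \<open>cofree_arr_eqI\<close> is the uniqueness half.\<close>

lemma cofree_lift:
  assumes H: "is_cofree Y S \<iota> \<pi> \<sigma>" and X: "(X, g) \<in> Obj \<E>" and \<phi>: "\<phi> \<Zcolon> X \<rightarrow> Y"
  obtains h where "h \<Zcolon>\<^bsub>\<E>\<^esub> (X, g) \<rightarrow> (S, \<sigma>)" "\<pi> 0 \<cdot> h = \<phi>"
proof -
  note H' = is_cofreeD[OF H] and X' = ext_objD[OF X]
  note b' = is_biproductD[OF H'(2)]
  \<comment> \<open>The components that \<open>cofree_proj\<close> leaves no choice about.\<close>
  let ?u = "\<lambda>j. if j = 0 then \<phi> else amap (G j) \<phi> \<cdot> g j"
  have u: "?u j \<Zcolon> X \<rightarrow> H_summand G Y j" if "j \<in> {0..n}" for j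
    using that \<phi> comp_arr[OF G_arr[OF _ \<phi>] X'(2), of j] by (simp add: H_summand_def)
  obtain h where h: "h \<Zcolon> X \<rightarrow> S" and hu: "\<And>j. j \<in> {0..n} \<Longrightarrow> \<pi> j \<cdot> h = ?u j"
    using biproduct_lift[OF H'(2) X'(1) u] by blast
  have "\<sigma> i \<cdot> h = amap (G i) h \<cdot> g i" if i: "i \<in> {1..n}" for i
  proof (rule biproduct_proj_jointly_monic[OF G_biproduct[OF i H'(2)] comp_arr[OF H'(4)[OF i] h]
        comp_arr[OF G_arr[OF i h] X'(2)[OF i]]])
    fix j assume j: "j \<in> {0..n}"
    note \<pi>j = b'(5)[OF j] and gi = X'(2)[OF i]
    have l: "amap (G i) (\<pi> j) \<cdot> (\<sigma> i \<cdot> h) = (amap (G i) (\<pi> j) \<cdot> \<sigma> i) \<cdot> h"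
      using comp_assoc[OF G_arr[OF i \<pi>j] H'(4)[OF i] h] by simp
    have r: "amap (G i) (\<pi> j) \<cdot> (amap (G i) h \<cdot> g i) = amap (G i) (?u j) \<cdot> g i"
      using comp_assoc[OF G_arr[OF i \<pi>j] G_arr[OF i h] gi] G_comp[OF i \<pi>j h] hu[OF j] by simp
    show "amap (G i) (\<pi> j) \<cdot> (\<sigma> i \<cdot> h) = amap (G i) (\<pi> j) \<cdot> (amap (G i) h \<cdot> g i)"
    \<comment> \<open>Row 0 holds by the choice of components. For \<open>j > 0\<close> the
      equations of the object \<open>(X, g)\<close> enter: with naturality of \<open>\<Psi>\<close>
      if \<open>i + j\<close> is in range, as vanishing otherwise.\<close>
    proof (cases "j = 0")
      case True
      then have ij: "i + j \<le> n" "i + j \<in> {0..n}" using i by auto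
      note e = H_entry_arr[OF H'(1) i ij(1)]
      have "(amap (G i) (\<pi> j) \<cdot> \<sigma> i) \<cdot> h = H_entry Y i j \<cdot> (\<pi> (i + j) \<cdot> h)"
        using H'(5)[OF i j ij(1)] comp_assoc[OF e b'(5)[OF ij(2)] h] by simp
      also have "\<dots> = Ident C (omap (G i) Y) \<cdot> (amap (G i) \<phi> \<cdot> g i)"
        using hu[OF ij(2)] True i by (simp add: H_entry_def)
      also have "\<dots> = amap (G i) \<phi> \<cdot> g i"
        using ident_comp[OF comp_arr[OF G_arr[OF i \<phi>] gi]] .
      finally show ?thesis using l r True by simp
    next
      case False
      then have j': "j \<in> {1..n}" using j by auto
      note gj = X'(2)[OF j'] and G\<phi> = G_arr[OF j' \<phi>]
      have r': "amap (G i) (?u j) \<cdot> g i = amap (G i) (amap (G j) \<phi>) \<cdot> (amap (G i) (g j) \<cdot> g i)"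
        using False G_comp[OF i G\<phi> gj] comp_assoc[OF G_arr[OF i G\<phi>] G_arr[OF i gj] gi] by simp
      show ?thesis
      proof (cases "i + j \<le> n")
        case True
        then have ij: "i + j \<in> {0..n}" "i + j \<in> {1..n}" using i by auto
        note e = H_entry_arr[OF H'(1) i True]
        note \<Psi>Y = \<Psi>_arr[OF i j' True H'(1)] and \<Psi>X = \<Psi>_arr[OF i j' True X'(1)]
        note gij = X'(2)[OF ij(2)]
        have "(amap (G i) (\<pi> j) \<cdot> \<sigma> i) \<cdot> h = H_entry Y i j \<cdot> (\<pi> (i + j) \<cdot> h)"
          using H'(5)[OF i j True] comp_assoc[OF e b'(5)[OF ij(1)] h] by simp
        also have "\<dots> = \<Psi> i j Y \<cdot> (amap (G (i + j)) \<phi> \<cdot> g (i + j))"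
          using hu[OF ij(1)] False by (simp add: H_entry_def)
        also have "\<dots> = amap (G i) (amap (G j) \<phi>) \<cdot> (\<Psi> i j X \<cdot> g (i + j))"
          using comp_assoc[OF \<Psi>Y G_arr[OF ij(2) \<phi>] gij] \<Psi>_natural[OF i j' True \<phi>]
            comp_assoc[OF G_arr[OF i G\<phi>] \<Psi>X gij] by simp
        finally show ?thesis using l r r' X'(3)[OF i j' True] by simp
      next
        case ij: False
        have "(amap (G i) (\<pi> j) \<cdot> \<sigma> i) \<cdot> h = Zero C X (omap (G i) (omap (G j) Y))"
          using H'(6)[OF i j ij] zero_comp[OF h G_obj[OF i b'(3)[OF j]]] False
          by (simp add: H_summand_def)
        then show ?thesis
          using l r r' X'(4)[OF i j' ij] comp_zero[OF G_arr[OF i G\<phi>] X'(1)] by simp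
      qed
    qed
  qed
  then have "h \<Zcolon>\<^bsub>\<E>\<^esub> (X, g) \<rightarrow> (S, \<sigma>)" using X h cofree_obj[OF H] by (simp add: ext_arr_iff)
  moreover have "\<pi> 0 \<cdot> h = \<phi>" using hu[of 0] by simp
  ultimately show thesis using that by blast
qed

text \<open>A monomorphism of the extension is monic in the base, so
  \<open>\<pi> 0 \<cdot> u\<close> extends into \<open>E\<close>; its lift to \<open>H(E)\<close>
  extends \<open>u\<close>, as the two agree under \<open>\<pi> 0\<close>.\<close>

lemma cofree_injective:
  assumes H: "is_cofree E S \<iota> \<pi> \<sigma>" and E: "injective_object C E"
  shows "injective_object \<E> (S, \<sigma>)"
  unfolding injective_object_def
proof (intro conjI allI impI)
  show S: "(S, \<sigma>) \<in> Obj \<E>" using cofree_obj[OF H] .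
  fix P Q m u assume mu: "monic \<E> P Q m \<and> u \<in> Hom \<E> P (S, \<sigma>)"
  obtain P' p Q' q where PQ: "P = (P', p)" "Q = (Q', q)" by (cases P; cases Q) auto
  then have m: "monic \<E> (P', p) (Q', q) m" using mu by simp
  note m' = monic_arr[OF m]
  have u: "u \<Zcolon>\<^bsub>\<E>\<^esub> (P', p) \<rightarrow> (S, \<sigma>)" using mu PQ S ext_arrD(1)[OF m'] by (simp add: arr_def)
  have \<pi>0: "\<pi> 0 \<Zcolon> S \<rightarrow> E"
    using is_biproductD(5)[OF is_cofreeD(2)[OF H], of 0] by (simp add: H_summand_def)
  obtain w where w: "w \<Zcolon> Q' \<rightarrow> E" "w \<cdot> m = \<pi> 0 \<cdot> u"
    using injective_object_extend[OF E ext_monic_imp_monic[OF m] comp_arr[OF \<pi>0 ext_arrD(3)[OF u]]] .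
  obtain v where v: "v \<Zcolon>\<^bsub>\<E>\<^esub> (Q', q) \<rightarrow> (S, \<sigma>)" "\<pi> 0 \<cdot> v = w"
    using cofree_lift[OF H ext_arrD(2)[OF m'] w(1)] .
  have "\<pi> 0 \<cdot> (v \<cdot> m) = \<pi> 0 \<cdot> u"
    using comp_assoc[OF \<pi>0 ext_arrD(3)[OF v(1)] ext_arrD(3)[OF m']] v(2) w(2) by simp
  then have "v \<cdot> m = u" by (rule cofree_arr_eqI[OF H ext_comp_arr[OF v(1) m'] u])
  then show "\<exists>v \<in> Hom \<E> Q (S, \<sigma>). v \<cdot>\<^bsub>\<E>\<^esub> m = u" using v(1) PQ by (auto simp: arr_def)
qed

subsection \<open>Injective objects\<close>

lemma direct_summand_H_injective:
  assumes E: "injective_object C E" and d: "direct_summand \<E> (X, f) (H_obj C n G \<Psi> E)"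
  shows "injective_object \<E> (X, f)"
proof -
  obtain S \<iota> \<pi> \<sigma> where HE: "H_obj C n G \<Psi> E = (S, \<sigma>)" and H: "is_cofree E S \<iota> \<pi> \<sigma>"
    using H_obj_is_cofree[OF injective_object_obj[OF E]] .
  obtain Y s i r p where "is_biproduct2 \<E> (X, f) Y (S, \<sigma>) s i r p"
    using d HE by (auto simp: direct_summand_def)
  then show ?thesis
    using is_category.injective_retract[OF is_category_ext cofree_injective[OF H E], of s "(X, f)" r]
    by (simp add: is_biproduct2_def arr_def)
qed

text \<open>The adjunct of a monomorphism into an injective \<open>E\<close> is a monomorphism into
  \<open>H(E)\<close>; injectivity of the source splits it, and the kernel of the splitting is the
  complement.\<close>

lemma injective_direct_summand_H:
  assumes en: "enough_injectives C" and inj: "injective_object \<E> (X, f)"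
  obtains E where "injective_object C E" "direct_summand \<E> (X, f) (H_obj C n G \<Psi> E)"
proof -
  note X = injective_object_obj[OF inj]
  obtain E e where E: "injective_object C E" and e: "monic C X E e"
    using en ext_objD(1)[OF X] unfolding enough_injectives_def by blast
  obtain S \<iota> \<pi> \<sigma> where HE: "H_obj C n G \<Psi> E = (S, \<sigma>)" and H: "is_cofree E S \<iota> \<pi> \<sigma>"
    using H_obj_is_cofree[OF injective_object_obj[OF E]] .
  have \<pi>0: "\<pi> 0 \<Zcolon> S \<rightarrow> E"
    using is_biproductD(5)[OF is_cofreeD(2)[OF H], of 0] by (simp add: H_summand_def)
  obtain h where h: "h \<Zcolon>\<^bsub>\<E>\<^esub> (X, f) \<rightarrow> (S, \<sigma>)" "\<pi> 0 \<cdot> h = e"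
    using cofree_lift[OF H X monic_arr[OF e]] .
  note h' = ext_arrD(3)[OF h(1)]
  have "monic C X S h"
  \<comment> \<open>\<open>h\<close> is monic because its composite with \<open>\<pi> 0\<close> is
    the monomorphism \<open>e\<close>.\<close>
  proof (rule monicI[OF h'])
    fix Z t assume t: "t \<Zcolon> Z \<rightarrow> X" and "h \<cdot> t = Zero C Z S"
    then have "e \<cdot> t = Zero C Z E"
      using comp_assoc[OF \<pi>0 h' t] h(2) comp_zero[OF \<pi>0 arr_obj(1)[OF t]] by simp
    then show "t = Zero C Z X" using monic_zero_cancel[OF e t] by simp
  qed
  then have "monic \<E> (X, f) (S, \<sigma>) h" by (rule ext_monicI[OF h(1)])
  moreover have "Ident C X \<Zcolon>\<^bsub>\<E>\<^esub> (X, f) \<rightarrow> (X, f)" using ext_ident_arr[OF X] .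
  ultimately obtain r where r: "r \<Zcolon>\<^bsub>\<E>\<^esub> (S, \<sigma>) \<rightarrow> (X, f)" "r \<cdot> h = Ident C X"
    using injective_object_extend[OF inj] by (metis ext_simps(1))
  obtain L l k p where "is_biproduct2 \<E> (X, f) (L, l) (S, \<sigma>) h k r p"
    using ext_split_monic_complement[OF h(1) r] .
  then have "direct_summand \<E> (X, f) (S, \<sigma>)" unfolding direct_summand_def by blast
  then show thesis using that E HE by simp
qed

text \<open>
  A retraction of \<open>K(X, f) \<rightarrow> X\<close> corresponds under the adjunction to a morphism
  \<open>(X, f) \<rightarrow> H(K(X, f))\<close> inducing an isomorphism on \<open>K\<close>. Its kernel, and then the complement of
  the image it splits off, are killed by \<open>K\<close>.
\<close>

lemma injective_isomorphic_H_K: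
  assumes inj: "injective_object \<E> (X, f)"
  shows "isomorphic_objects \<E> (H_obj C n G \<Psi> (K_obj C n G (X, f))) (X, f)"
proof -
  note X = injective_object_obj[OF inj]
  note X' = ext_objD[OF X]
  let ?K = "K_obj C n G (X, f)"
  obtain k where mk: "monic C ?K X k"
    and kz: "\<And>i. i \<in> {1..n} \<Longrightarrow> f i \<cdot> k = Zero C ?K (omap (G i) X)"
    and ku: "\<And>Z t. \<lbrakk>t \<Zcolon> Z \<rightarrow> X; \<And>i. i \<in> {1..n} \<Longrightarrow> f i \<cdot> t = Zero C Z (omap (G i) X)\<rbrakk>
      \<Longrightarrow> \<exists>u. u \<Zcolon> Z \<rightarrow> ?K \<and> k \<cdot> u = t"
    using K_obj_universal[OF X] by blast
  note k = monic_arr[OF mk]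
  note K = arr_obj(1)[OF k]
  \<comment> \<open>The retraction exists because \<open>K(X, f)\<close> is already known to be
    injective.\<close>
  obtain \<rho> where \<rho>: "\<rho> \<Zcolon> X \<rightarrow> ?K" "\<rho> \<cdot> k = Ident C ?K"
    using injective_object_extend[OF K_obj_injective[OF inj] mk ident_arr[OF K]] .
  obtain S \<iota> \<pi> \<sigma> where HK: "H_obj C n G \<Psi> ?K = (S, \<sigma>)" and H: "is_cofree ?K S \<iota> \<pi> \<sigma>"
    using H_obj_is_cofree[OF K] .
  note H' = is_cofreeD[OF H]
  note b' = is_biproductD[OF H'(2)]
  note S = b'(2)
  have \<pi>0: "\<pi> 0 \<Zcolon> S \<rightarrow> ?K" using b'(5)[of 0] by (simp add: H_summand_def)
  obtain h where h: "h \<Zcolon>\<^bsub>\<E>\<^esub> (X, f) \<rightarrow> (S, \<sigma>)" and h\<rho>: "\<pi> 0 \<cdot> h = \<rho>"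
    using cofree_lift[OF H X \<rho>(1)] .
  note h' = ext_arrD(3)[OF h]
  have mh: "monic C X S h"
  proof -
    obtain L l c where Lc: "is_kernel C X S h L c" and c: "c \<Zcolon>\<^bsub>\<E>\<^esub> (L, l) \<rightarrow> (X, f)"
      using ext_kernel[OF h] .
    note c' = ext_arrD[OF c]
    \<comment> \<open>If \<open>l\<close> kills \<open>t\<close>, then \<open>f\<close> kills
      \<open>c \<cdot> t\<close>, which is therefore \<open>k \<cdot> u\<close>. As \<open>h\<close>
      kills \<open>c\<close> and \<open>\<rho>\<close> factors through \<open>h\<close>,
      \<open>u = \<rho> \<cdot> k \<cdot> u\<close> is zero.\<close>
    have "Ident C L = Zero C L L"
    proof (rule ext_ident_zero[OF c'(1)])
      fix Z t assume t: "t \<Zcolon> Z \<rightarrow> L" and lt: "\<And>i. i \<in> {1..n} \<Longrightarrow> l i \<cdot> t = Zero C Z (omap (G i) L)"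
      note Z = arr_obj(1)[OF t]
      have "f i \<cdot> (c \<cdot> t) = Zero C Z (omap (G i) X)" if i: "i \<in> {1..n}" for i
        using comp_assoc[OF X'(2)[OF i] c'(3) t] c'(4)[OF i]
          comp_assoc[OF G_arr[OF i c'(3)] ext_objD(2)[OF c'(1) i] t] lt[OF i]
          comp_zero[OF G_arr[OF i c'(3)] Z] by simp
      then obtain u where u: "u \<Zcolon> Z \<rightarrow> ?K" "k \<cdot> u = c \<cdot> t" using ku[OF comp_arr[OF c'(3) t]] by blast
      have "h \<cdot> (c \<cdot> t) = Zero C Z S"
        using comp_assoc[OF h' c'(3) t] is_kernel_zero[OF Lc] zero_comp[OF t S] by simp
      then have "\<rho> \<cdot> (k \<cdot> u) = Zero C Z ?K"
        using comp_assoc[OF \<pi>0 h' comp_arr[OF c'(3) t]] h\<rho> u(2) comp_zero[OF \<pi>0 Z] by simp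
      then have "u = Zero C Z ?K"
        using comp_assoc[OF \<rho>(1) k u(1)] \<rho>(2) ident_comp[OF u(1)] by simp
      then have "c \<cdot> t = Zero C Z X" using u(2) comp_zero[OF k Z] by simp
      then show "t = Zero C Z L" using monic_zero_cancel[OF is_kernel_monic[OF Lc] t] by simp
    qed
    then have c0: "c = Zero C L X"
      using comp_ident[OF c'(3)] comp_zero[OF c'(3) arr_obj(1)[OF c'(3)]] by simp
    show ?thesis
    proof (rule monicI[OF h'])
      fix Z t assume "t \<Zcolon> Z \<rightarrow> X" "h \<cdot> t = Zero C Z S"
      then obtain u where "u \<Zcolon> Z \<rightarrow> L" "c \<cdot> u = t" using is_kernel_lift[OF Lc] by blast
      then show "t = Zero C Z X" using c0 zero_comp[OF _ X'(1)] by auto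
    qed
  qed
  obtain r where r: "r \<Zcolon>\<^bsub>\<E>\<^esub> (S, \<sigma>) \<rightarrow> (X, f)" "r \<cdot> h = Ident C X"
    using injective_object_extend[OF inj ext_monicI[OF h mh] ext_ident_arr[OF X]] by auto
  note r' = ext_arrD(3)[OF r(1)]
  obtain L l c p where "is_biproduct2 \<E> (X, f) (L, l) (S, \<sigma>) h c r p"
    using ext_split_monic_complement[OF h r] .
  then have c: "c \<Zcolon>\<^bsub>\<E>\<^esub> (L, l) \<rightarrow> (S, \<sigma>)" and p: "p \<Zcolon>\<^bsub>\<E>\<^esub> (S, \<sigma>) \<rightarrow> (L, l)"
    and pc: "p \<cdot> c = Ident C L" and rc: "r \<cdot> c = Zero C L X"
    and sum: "Add C (h \<cdot> r) (c \<cdot> p) = Ident C S"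
    by (auto simp: is_biproduct2_def arr_def)
  note c' = ext_arrD[OF c] and p' = ext_arrD(3)[OF p]
  \<comment> \<open>Surjectivity of \<open>h\<close> on \<open>K\<close>: a map killed by
    \<open>\<sigma>\<close> has only its component at 0, since \<open>\<pi> j\<close> factors
    through \<open>\<sigma> j\<close> for \<open>j > 0\<close>. The map \<open>h \<cdot> k\<close>
    realizes any such component because \<open>f\<close> kills \<open>k\<close> and
    \<open>\<rho>\<close> retracts it.\<close>
  have killed: "t = h \<cdot> (k \<cdot> (\<pi> 0 \<cdot> t))"
    if t: "t \<Zcolon> Z \<rightarrow> S" and \<sigma>t: "\<And>i. i \<in> {1..n} \<Longrightarrow> \<sigma> i \<cdot> t = Zero C Z (omap (G i) S)" for Z t
  proof (rule biproduct_proj_jointly_monic[OF H'(2) t])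
    note Z = arr_obj(1)[OF t]
    note \<pi>t = comp_arr[OF \<pi>0 t]
    note k\<pi>t = comp_arr[OF k \<pi>t]
    show "h \<cdot> (k \<cdot> (\<pi> 0 \<cdot> t)) \<Zcolon> Z \<rightarrow> S" using comp_arr[OF h' k\<pi>t] .
    fix j assume j: "j \<in> {0..n}"
    show "\<pi> j \<cdot> t = \<pi> j \<cdot> (h \<cdot> (k \<cdot> (\<pi> 0 \<cdot> t)))"
    proof (cases "j = 0")
      case True
      then show ?thesis
        using comp_assoc[OF \<pi>0 h' k\<pi>t] h\<rho> comp_assoc[OF \<rho>(1) k \<pi>t] \<rho>(2) ident_comp[OF \<pi>t] by simp
    next
      case False
      then have i: "j \<in> {1..n}" using j by simp
      note G\<pi> = G_arr[OF i \<pi>0] and G\<rho> = G_arr[OF i \<rho>(1)] and \<pi>j = b'(5)[OF j]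
      have \<pi>j': "\<pi> j \<Zcolon> S \<rightarrow> omap (G j) ?K" using \<pi>j False by (simp add: H_summand_def)
      have "amap (G j) (\<pi> 0) \<cdot> \<sigma> j = \<pi> j"
        using H'(5)[OF i, of 0] i ident_comp[OF \<pi>j'] by (simp add: H_entry_def)
      then have "\<pi> j \<cdot> t = Zero C Z (omap (G j) ?K)"
        using comp_assoc[OF G\<pi> H'(4)[OF i] t] \<sigma>t[OF i] comp_zero[OF G\<pi> Z] by simp
      moreover have "\<pi> j \<cdot> (h \<cdot> (k \<cdot> (\<pi> 0 \<cdot> t))) = amap (G j) \<rho> \<cdot> ((f j \<cdot> k) \<cdot> (\<pi> 0 \<cdot> t))"
        using comp_assoc[OF \<pi>j h' k\<pi>t] cofree_proj[OF H h i] h\<rho>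
          comp_assoc[OF G\<rho> X'(2)[OF i] k\<pi>t] comp_assoc[OF X'(2)[OF i] k \<pi>t] by simp
      moreover have "\<dots> = Zero C Z (omap (G j) ?K)"
        using kz[OF i] zero_comp[OF \<pi>t G_obj[OF i X'(1)]] comp_zero[OF G\<rho> Z] by simp
      ultimately show ?thesis by simp
    qed
  qed
  \<comment> \<open>A map into the complement killed by \<open>l\<close> lands in the image of
    \<open>h\<close> by \<open>killed\<close>. Since \<open>r\<close> kills \<open>c\<close> but
    inverts \<open>h\<close> on the left, it vanishes.\<close>
  have "Ident C L = Zero C L L"
  proof (rule ext_ident_zero[OF c'(1)])
    fix Z t assume t: "t \<Zcolon> Z \<rightarrow> L" and lt: "\<And>i. i \<in> {1..n} \<Longrightarrow> l i \<cdot> t = Zero C Z (omap (G i) L)"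
    note Z = arr_obj(1)[OF t]
    note ct = comp_arr[OF c'(3) t]
    have "\<sigma> i \<cdot> (c \<cdot> t) = Zero C Z (omap (G i) S)" if i: "i \<in> {1..n}" for i
      using comp_assoc[OF H'(4)[OF i] c'(3) t] c'(4)[OF i]
        comp_assoc[OF G_arr[OF i c'(3)] ext_objD(2)[OF c'(1) i] t] lt[OF i]
        comp_zero[OF G_arr[OF i c'(3)] Z] by simp
    then have ct_eq: "c \<cdot> t = h \<cdot> (k \<cdot> (\<pi> 0 \<cdot> (c \<cdot> t)))" by (rule killed[OF ct])
    note k\<pi>ct = comp_arr[OF k comp_arr[OF \<pi>0 ct]]
    have "k \<cdot> (\<pi> 0 \<cdot> (c \<cdot> t)) = r \<cdot> (h \<cdot> (k \<cdot> (\<pi> 0 \<cdot> (c \<cdot> t))))"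
      using comp_assoc[OF r' h' k\<pi>ct] r(2) ident_comp[OF k\<pi>ct] by simp
    also have "\<dots> = r \<cdot> (c \<cdot> t)" using ct_eq by simp
    also have "\<dots> = Zero C Z X" using comp_assoc[OF r' c'(3) t] rc zero_comp[OF t X'(1)] by simp
    finally have "c \<cdot> t = Zero C Z S" using ct_eq comp_zero[OF h' Z] by simp
    then have "p \<cdot> (c \<cdot> t) = Zero C Z L" using comp_zero[OF p' Z] by simp
    then show "t = Zero C Z L" using comp_assoc[OF p' c'(3) t] pc ident_comp[OF t] by simp
  qed
  \<comment> \<open>The complement being zero, the biproduct identity reduces to
    \<open>h \<cdot> r = Ident C S\<close>, so the split monomorphism \<open>h\<close> is
    invertible.\<close>
  then have "p = Zero C S L"
    using ident_comp[OF p'] zero_comp[OF p' arr_obj(2)[OF p']] by simp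
  then have "h \<cdot> r = Ident C S"
    using sum comp_zero[OF c'(3) S] add_zero[OF comp_arr[OF h' r']] by simp
  then show ?thesis
    using HK h r unfolding isomorphic_objects_def arr_def by auto
qed

text \<open>One of the two isomorphism equations already exhibits \<open>(X, f)\<close> as a retract
  of the injective \<open>H(E)\<close>.\<close>

lemma isomorphic_H_injective:
  assumes E: "injective_object C E" and iso: "isomorphic_objects \<E> (H_obj C n G \<Psi> E) (X, f)"
  shows "injective_object \<E> (X, f)"
proof -
  obtain S \<iota> \<pi> \<sigma> where HE: "H_obj C n G \<Psi> E = (S, \<sigma>)" and H: "is_cofree E S \<iota> \<pi> \<sigma>"
    using H_obj_is_cofree[OF injective_object_obj[OF E]] .
  obtain u v where "u \<Zcolon>\<^bsub>\<E>\<^esub> (S, \<sigma>) \<rightarrow> (X, f)" "v \<Zcolon>\<^bsub>\<E>\<^esub> (X, f) \<rightarrow> (S, \<sigma>)"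
    "u \<cdot>\<^bsub>\<E>\<^esub> v = Ident \<E> (X, f)"
    using iso HE unfolding isomorphic_objects_def arr_def by auto
  then show ?thesis
    using is_category.injective_retract[OF is_category_ext cofree_injective[OF H E]] by blast
qed

end

theorem corollary3p6:
  fixes \<A> :: "('o, 'm) preadd_category"
    and n :: nat
    and F G :: "nat \<Rightarrow> ('o, 'm) endofunctor_data"
    and \<Psi> :: "nat \<Rightarrow> nat \<Rightarrow> 'o \<Rightarrow> 'm"
    and X :: 'o
    and f :: "nat \<Rightarrow> 'm"
  assumes "abelian_category \<A>"
    and "n \<ge> 1"
    and "\<And>i. i \<in> {1..n} \<Longrightarrow> additive_functor \<A> \<A> (G i)"
    and "\<And>i. i \<in> {1..n} \<Longrightarrow> left_exact_functor \<A> \<A> (G i)"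
    and "\<And>i. i \<in> {1..n} \<Longrightarrow> is_functor \<A> \<A> (F i)"
    and "\<And>i. i \<in> {1..n} \<Longrightarrow> right_adjoint_of \<A> \<A> (G i) (F i)"
    and "natural_family \<A> n G \<Psi>"
    and "coassociative \<A> n G \<Psi>"
    and "enough_injectives \<A>"
    and "(X, f) \<in> Obj (trivial_extension \<A> n G \<Psi>)"
  shows "(injective_object (trivial_extension \<A> n G \<Psi>) (X, f) \<longleftrightarrow>
           (\<exists>E. injective_object \<A> E \<and>
              direct_summand (trivial_extension \<A> n G \<Psi>) (X, f) (H_obj \<A> n G \<Psi> E)))
       \<and> ((\<exists>E. injective_object \<A> E \<and>
              direct_summand (trivial_extension \<A> n G \<Psi>) (X, f) (H_obj \<A> n G \<Psi> E)) \<longleftrightarrow>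
           injective_object \<A> (K_obj \<A> n G (X, f)) \<and>
           isomorphic_objects (trivial_extension \<A> n G \<Psi>)
             (H_obj \<A> n G \<Psi> (K_obj \<A> n G (X, f))) (X, f))"
proof -
  interpret left_trivial_extension \<A> n G \<Psi>
    using assms(1,3,4,7,8)
    by (simp add: left_trivial_extension_def left_trivial_extension_axioms_def)
  \<comment> \<open>All implications pass through (i): it is equivalent to (ii) by the two direct
    summand lemmas, and to (iii) by taking \<open>E\<close> to be \<open>K(X, f)\<close> for the way
    back.\<close>
  show ?thesis
    using direct_summand_H_injective injective_direct_summand_H[OF assms(9)] K_obj_injective
      injective_isomorphic_H_K isomorphic_H_injective by metis
qed

end
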